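(* Let $\theta$ be a uniclass automorphism of a thick irreducible spherical building $\Delta$. Then $\theta$ is capped.
   Context: Let $(W,S)$ be the type of $\Delta$, $\delta$ the Weyl distance, and $w_0$ the longest element of $W$. Automorphisms need not preserve types; the companion automorphism $\sigma$ of $\theta$ is the automorphism of the Coxeter graph with $\delta(C,D)=s\iff\delta(C^\theta,D^\theta)=s^\sigma$. $\theta$ is uniclass if $\mathrm{disp}(\theta)=\{\delta(C,C^\theta)\mid C\text{ a chamber}\}$ is contained in a single $\sigma$-conjugacy class $\{v^{-1}wv^\sigma\mid v\in W\}$. Simplices $\alpha,\beta$ are opposite if $\tau(\beta)=w_0\tau(\alpha)w_0$, where $\tau$ denotes the type, and there are chambers $A\supseteq\alpha$, $B\supseteq\beta$ with $\delta(A,B)=w_0$. $\theta$ is capped if whenever there exist simplices of types $J$ and $J'$ that are mapped onto opposite simplices by $\theta$, there exists a simplex of type $J\cup J'$ mapped onto an opposite simplex by $\theta$. Thick means every panel lies in at least three chambers. *)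

theory Defs
  imports "HOL-Algebra.Algebra"
begin

section \<open>Coxeter systems\<close>

text \<open>
  The entries of the Coxeter matrix are \<open>m s t\<close>, with value 0 standing for infinity.
  The generators satisfy the relation \<open>s s = 1\<close> (the case \<open>m s s = 1\<close>), so the group presentation
  with relators \<open>(s t)^(m s t)\<close> is the same as the monoid presentation by these relators, and
  plain words over \<open>S\<close> suffice.
\<close>

inductive coxeter_eq :: "('w \<Rightarrow> 'w \<Rightarrow> nat) \<Rightarrow> 'w set \<Rightarrow> 'w list \<Rightarrow> 'w list \<Rightarrow> bool"
  for m :: "'w \<Rightarrow> 'w \<Rightarrow> nat" and S :: "'w set" where
  rel: "\<lbrakk>set u \<subseteq> S; set v \<subseteq> S; s \<in> S; t \<in> S\<rbrakk>
    \<Longrightarrow> coxeter_eq m S (u @ concat (replicate (m s t) [s, t]) @ v) (u @ v)"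
| refl: "set u \<subseteq> S \<Longrightarrow> coxeter_eq m S u u"
| sym: "coxeter_eq m S u v \<Longrightarrow> coxeter_eq m S v u"
| trans: "coxeter_eq m S u v \<Longrightarrow> coxeter_eq m S v w \<Longrightarrow> coxeter_eq m S u w"

definition word_prod :: "('w, 'b) monoid_scheme \<Rightarrow> 'w list \<Rightarrow> 'w" where
  "word_prod W u = foldr (\<lambda>x y. x \<otimes>\<^bsub>W\<^esub> y) u \<one>\<^bsub>W\<^esub>"

text \<open>
  The assumption \<open>presentation\<close> says that \<open>W\<close> is presented by the generators \<open>S\<close>
  and the relators \<open>(s t)^(m s t)\<close> with \<open>m s t\<close> the order of \<open>s t\<close>.
\<close>

locale coxeter_system = group W for W (structure) +
  fixes S :: "'a set"
  assumes S_subset: "S \<subseteq> carrier W"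
    and generates: "generate W S = carrier W"
    and order_two: "s \<in> S \<Longrightarrow> ord s = 2"
    and presentation: "\<lbrakk>set u \<subseteq> S; set v \<subseteq> S; word_prod W u = word_prod W v\<rbrakk>
      \<Longrightarrow> coxeter_eq (\<lambda>s t. ord (s \<otimes> t)) S u v"
begin

definition len :: "'a \<Rightarrow> nat" where
  "len w = (LEAST n. \<exists>u. set u \<subseteq> S \<and> length u = n \<and> word_prod W u = w)"

definition coxeter_graph :: "('a \<times> 'a) set" where
  "coxeter_graph = {(s, t). s \<in> S \<and> t \<in> S \<and> s \<noteq> t \<and> ord (s \<otimes> t) \<noteq> 2}"

definition irreducible_type :: bool where
  "irreducible_type \<longleftrightarrow> (\<forall>s\<in>S. \<forall>t\<in>S. (s, t) \<in> coxeter_graph\<^sup>*)"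

definition spherical_type :: bool where
  "spherical_type \<longleftrightarrow> finite (carrier W)"

definition longest :: 'a where
  "longest = (THE w. w \<in> carrier W \<and> (\<forall>v\<in>carrier W. len v \<le> len w))"

text \<open>
  An automorphism of the Coxeter graph is identified with its unique extension to an
  automorphism of the group \<open>W\<close>, as needed for writing \<open>\<sigma> v\<close> with \<open>v\<close> in \<open>W\<close>.
\<close>

definition graph_automorphism :: "('a \<Rightarrow> 'a) \<Rightarrow> bool" where
  "graph_automorphism \<sigma> \<longleftrightarrow> \<sigma> \<in> iso W W \<and> \<sigma> ` S = S"

definition twisted_class :: "('a \<Rightarrow> 'a) \<Rightarrow> 'a \<Rightarrow> 'a set" where
  "twisted_class \<sigma> w = {inv v \<otimes> w \<otimes> \<sigma> v | v. v \<in> carrier W}"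

end

section \<open>Buildings\<close>

text \<open>
  Buildings of type \<open>(W, S)\<close>, given by the set \<open>Ch\<close> of chambers and the Weyl distance \<open>\<delta>\<close>
  (the axioms (WD1)--(WD3) of Abramenko and Brown).
\<close>

locale building = coxeter_system W S for W (structure) and S +
  fixes Ch :: "'c set" and \<delta> :: "'c \<Rightarrow> 'c \<Rightarrow> 'a"
  assumes chambers_nonempty: "Ch \<noteq> {}"
    and dist_closed: "\<lbrakk>C \<in> Ch; D \<in> Ch\<rbrakk> \<Longrightarrow> \<delta> C D \<in> carrier W"
    and WD1: "\<lbrakk>C \<in> Ch; D \<in> Ch\<rbrakk> \<Longrightarrow> \<delta> C D = \<one> \<longleftrightarrow> C = D"
    and WD2: "\<lbrakk>C \<in> Ch; D \<in> Ch; C' \<in> Ch; s \<in> S; \<delta> C' C = s\<rbrakk>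
      \<Longrightarrow> \<delta> C' D \<in> {s \<otimes> \<delta> C D, \<delta> C D}"
    and WD2_longer: "\<lbrakk>C \<in> Ch; D \<in> Ch; C' \<in> Ch; s \<in> S; \<delta> C' C = s;
        len (s \<otimes> \<delta> C D) = len (\<delta> C D) + 1\<rbrakk> \<Longrightarrow> \<delta> C' D = s \<otimes> \<delta> C D"
    and WD3: "\<lbrakk>C \<in> Ch; D \<in> Ch; s \<in> S\<rbrakk>
      \<Longrightarrow> \<exists>C'\<in>Ch. \<delta> C' C = s \<and> \<delta> C' D = s \<otimes> \<delta> C D"
begin

text \<open>
  A simplex is represented by the set of chambers containing it: a simplex of type
  \<open>J\<close> (its vertices having the types in \<open>J\<close>) is a residue of type \<open>S - J\<close>. Thus \<open>A \<in> \<alpha>\<close> means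
  that the chamber \<open>A\<close> contains \<open>\<alpha>\<close>, a chamber \<open>C\<close> is the simplex \<open>{C}\<close> of type \<open>S\<close>, the face
  relation is reverse inclusion, and the empty simplex is \<open>Ch\<close>. A map \<open>\<theta>\<close> on chambers acts on
  simplices by taking images.
\<close>

definition simplex_of_type :: "'a set \<Rightarrow> 'c set \<Rightarrow> bool" where
  "simplex_of_type J \<alpha> \<longleftrightarrow>
    J \<subseteq> S \<and> (\<exists>A\<in>Ch. \<alpha> = {B \<in> Ch. \<delta> A B \<in> generate W (S - J)})"

definition simplex :: "'c set \<Rightarrow> bool" where
  "simplex \<alpha> \<longleftrightarrow> (\<exists>J. simplex_of_type J \<alpha>)"

definition thick :: bool where
  "thick \<longleftrightarrow> (\<forall>s\<in>S. \<forall>\<pi>. simplex_of_type (S - {s}) \<pi> \<longrightarrow> infinite \<pi> \<or> 3 \<le> card \<pi>)"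

definition opposite :: "'c set \<Rightarrow> 'c set \<Rightarrow> bool" where
  "opposite \<alpha> \<beta> \<longleftrightarrow>
    (\<exists>J. simplex_of_type J \<alpha> \<and>
         simplex_of_type ((\<lambda>s. longest \<otimes> s \<otimes> longest) ` J) \<beta>) \<and>
    (\<exists>A\<in>\<alpha>. \<exists>B\<in>\<beta>. \<delta> A B = longest)"

text \<open>Automorphisms are those of the simplicial complex; types need not be preserved.\<close>

definition automorphism :: "('c \<Rightarrow> 'c) \<Rightarrow> bool" where
  "automorphism \<theta> \<longleftrightarrow>
    bij_betw \<theta> Ch Ch \<and> (\<forall>\<alpha>. \<alpha> \<subseteq> Ch \<longrightarrow> (simplex (\<theta> ` \<alpha>) \<longleftrightarrow> simplex \<alpha>))"

definition companion :: "('c \<Rightarrow> 'c) \<Rightarrow> ('a \<Rightarrow> 'a) \<Rightarrow> bool" where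
  "companion \<theta> \<sigma> \<longleftrightarrow> graph_automorphism \<sigma> \<and>
    (\<forall>C\<in>Ch. \<forall>D\<in>Ch. \<forall>s\<in>S. \<delta> C D = s \<longleftrightarrow> \<delta> (\<theta> C) (\<theta> D) = \<sigma> s)"

definition disp :: "('c \<Rightarrow> 'c) \<Rightarrow> 'a set" where
  "disp \<theta> = {\<delta> C (\<theta> C) | C. C \<in> Ch}"

text \<open>On \<open>W\<close>, the companion automorphism is determined by \<open>\<theta>\<close>.\<close>

definition uniclass :: "('c \<Rightarrow> 'c) \<Rightarrow> bool" where
  "uniclass \<theta> \<longleftrightarrow>
    (\<exists>\<sigma>. companion \<theta> \<sigma> \<and> (\<exists>w\<in>carrier W. disp \<theta> \<subseteq> twisted_class \<sigma> w))"

definition capped :: "('c \<Rightarrow> 'c) \<Rightarrow> bool" where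
  "capped \<theta> \<longleftrightarrow>
    (\<forall>J J'. (\<exists>\<alpha>. simplex_of_type J \<alpha> \<and> opposite \<alpha> (\<theta> ` \<alpha>)) \<and>
            (\<exists>\<alpha>'. simplex_of_type J' \<alpha>' \<and> opposite \<alpha>' (\<theta> ` \<alpha>'))
        \<longrightarrow> (\<exists>\<beta>. simplex_of_type (J \<union> J') \<beta> \<and> opposite \<beta> (\<theta> ` \<beta>)))"

end

end

theory Submission
  imports Defs "HOL-Library.Sublist"
begin

text \<open>
  Write \<open>f C\<close> for the displacement \<open>\<delta> C (\<theta> C)\<close>. For a uniclass \<open>\<theta>\<close> all \<open>f C\<close> have lengths of the
  same parity, so passing to an \<open>s\<close>-adjacent chamber either keeps \<open>f C = u\<close> or replaces it by
  \<open>s u \<sigma>(s)\<close>. By thickness the latter never has the same length as \<open>u\<close> without being equal to \<open>u\<close>,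
  and if it is longer, it is the displacement of all \<open>s\<close>-neighbours. The relation
  \<open>u \<rightarrow> s u \<sigma>(s)\<close> (length increasing by 2) on displacements is terminating, and it is locally
  confluent: if \<open>s\<close> and \<open>t\<close> both increase \<open>f C\<close>, then along a reduced gallery in the residue of type
  \<open>{s, t}\<close> from \<open>C\<close> to an opposite chamber \<open>D\<close>, the displacements stay strictly longer than \<open>f C\<close>
  before \<open>D\<close>, and by thickness \<open>D\<close> can be chosen so that this also holds at \<open>D\<close>; the galleries
  starting with \<open>s\<close> and with \<open>t\<close> meet at \<open>D\<close>. By Newman's argument normal forms are unique, and as
  the building is connected, there is a single normal form \<open>z\<close>.

  If a simplex of type \<open>J\<close> is mapped to an opposite one, then \<open>\<sigma>(J) = w\<^sub>0 J w\<^sub>0\<close> and some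
  displacement lies in \<open>W\<^bsub>S-J\<^esub> w\<^sub>0\<close>; the converse holds as well, and the relation preserves this coset. Hence types \<open>J\<close> and \<open>J'\<close> force
  \<open>z\<close> into \<open>W\<^bsub>S-J\<^esub> w\<^sub>0 \<inter> W\<^bsub>S-J'\<^esub> w\<^sub>0 = W\<^bsub>S-(J\<union>J')\<^esub> w\<^sub>0\<close>.
\<close>

lemma subseq_set: "subseq v u \<Longrightarrow> set v \<subseteq> set u"
  by (induction rule: list_emb.induct) auto

context group
begin

lemma inv_cancel [simp]:
  assumes "g \<in> carrier G" "y \<in> carrier G"
  shows "inv g \<otimes> (g \<otimes> y) = y" "g \<otimes> (inv g \<otimes> y) = y"
  using assms by (simp_all flip: m_assoc)

end

section \<open>Words and inversions\<close>

context coxeter_system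
begin

lemma S_carrier [simp]: "s \<in> S \<Longrightarrow> s \<in> carrier W"
  using S_subset by blast

lemma S_sq [simp]: "s \<in> S \<Longrightarrow> s \<otimes> s = \<one>"
  using pow_ord_eq_1[of s] order_two[of s] by (simp add: numeral_2_eq_2)

lemma S_inv [simp]: "s \<in> S \<Longrightarrow> inv s = s"
  by (simp add: inv_equality)

lemma S_cancel [simp]: "s \<in> S \<Longrightarrow> y \<in> carrier W \<Longrightarrow> s \<otimes> (s \<otimes> y) = y"
  using inv_cancel(1)[of s y] by simp

lemma S_cancel_right [simp]: "s \<in> S \<Longrightarrow> y \<in> carrier W \<Longrightarrow> y \<otimes> s \<otimes> s = y"
  by (simp add: m_assoc)

lemma one_notin_S: "\<one> \<notin> S"
  using order_two[of \<one>] by auto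

lemma word_prod_Nil [simp]: "word_prod W [] = \<one>"
  by (simp add: word_prod_def)

lemma word_prod_Cons [simp]: "word_prod W (s # u) = s \<otimes> word_prod W u"
  by (simp add: word_prod_def)

lemma word_prod_closed [simp]: "set u \<subseteq> S \<Longrightarrow> word_prod W u \<in> carrier W"
  by (induction u) auto

lemma word_prod_append:
  "set u \<subseteq> S \<Longrightarrow> set v \<subseteq> S \<Longrightarrow> word_prod W (u @ v) = word_prod W u \<otimes> word_prod W v"
  by (induction u) (auto simp: m_assoc)

lemma word_prod_rev: "set u \<subseteq> S \<Longrightarrow> word_prod W (rev u) = inv (word_prod W u)"
  by (induction u) (auto simp: word_prod_append inv_mult_group)

text \<open>Generators are involutions, so words without formal inverses exhaust the generated
  subgroup.\<close>

lemma generate_eq_words: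
  assumes "K \<subseteq> S"
  shows "generate W K = word_prod W ` {u. set u \<subseteq> K}"
proof (intro equalityI subsetI)
  fix x assume "x \<in> generate W K"
  then show "x \<in> word_prod W ` {u. set u \<subseteq> K}"
  proof induction
    case one
    show ?case by (rule image_eqI[of _ _ "[]"]) auto
  next
    case (incl h)
    then show ?case using assms by (intro image_eqI[of _ _ "[h]"]) auto
  next
    case (inv h)
    then have "h \<in> S" using assms by blast
    with inv show ?case by (intro image_eqI[of _ _ "[h]"]) auto
  next
    case (eng h1 h2)
    then obtain u v where "h1 = word_prod W u" "h2 = word_prod W v" "set u \<subseteq> K" "set v \<subseteq> K"
      by blast
    then show ?case
      using assms by (intro image_eqI[of _ _ "u @ v"]) (auto simp: word_prod_append)
  qed
next
  fix x assume "x \<in> word_prod W ` {u. set u \<subseteq> K}"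
  then obtain u where "x = word_prod W u" "set u \<subseteq> K" by blast
  then show "x \<in> generate W K"
    by (induction u arbitrary: x) (auto intro: generate.intros)
qed

lemma generate_words:
  assumes "K \<subseteq> S" "x \<in> generate W K"
  obtains u where "set u \<subseteq> K" "word_prod W u = x"
  using assms(2) unfolding generate_eq_words[OF assms(1)] by auto

lemma generate_wordI: "K \<subseteq> S \<Longrightarrow> set u \<subseteq> K \<Longrightarrow> word_prod W u \<in> generate W K"
  by (simp add: generate_eq_words)

lemma generate_carrier: "K \<subseteq> S \<Longrightarrow> x \<in> generate W K \<Longrightarrow> x \<in> carrier W"
  using generate_in_carrier[of K] S_subset by blast

lemma generate_inv: "K \<subseteq> S \<Longrightarrow> x \<in> generate W K \<Longrightarrow> inv x \<in> generate W K"
  using generate_m_inv_closed[of K] S_subset by blast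

lemma words_exist:
  assumes "x \<in> carrier W"
  obtains u where "set u \<subseteq> S" "word_prod W u = x"
  by (rule generate_words[of S x]) (use assms generates that in auto)

text \<open>For a word s_1 ... s_k the i-th entry is the reflection s_1 ... s_(i-1) s_i s_(i-1) ...
  s_1. Left multiplication by it deletes the i-th letter.\<close>

primrec inversions :: "'a list \<Rightarrow> 'a list" where
  "inversions [] = []"
| "inversions (s # u) = s # map (\<lambda>t. s \<otimes> t \<otimes> s) (inversions u)"

lemma inversions_carrier [simp]: "set u \<subseteq> S \<Longrightarrow> set (inversions u) \<subseteq> carrier W"
  by (induction u) auto

lemma inversions_append:
  "set u \<subseteq> S \<Longrightarrow> set v \<subseteq> S \<Longrightarrow> inversions (u @ v) =
    inversions u @ map (\<lambda>t. word_prod W u \<otimes> t \<otimes> inv (word_prod W u)) (inversions v)"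
proof (induction u)
  case Nil
  then show ?case using inversions_carrier[of v] by (auto simp: subset_iff intro!: map_idI[symmetric])
next
  case (Cons s u)
  then show ?case
    using inversions_carrier[of v]
    by (auto simp: m_assoc inv_mult_group subset_iff)
qed

lemma conj_eq_iff:
  assumes "g \<in> carrier W" "x \<in> carrier W" "t \<in> carrier W"
  shows "g \<otimes> x \<otimes> inv g = t \<longleftrightarrow> x = inv g \<otimes> t \<otimes> g"
  using assms by (auto simp: m_assoc)

lemma count_list_conj:
  assumes "g \<in> carrier W" "set xs \<subseteq> carrier W" "t \<in> carrier W"
  shows "count_list (map (\<lambda>x. g \<otimes> x \<otimes> inv g) xs) t = count_list xs (inv g \<otimes> t \<otimes> g)"
  using assms by (induction xs) (auto simp: conj_eq_iff)

lemma word_prod_alternating: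
  assumes "s \<in> S" "t \<in> S"
  shows "word_prod W (concat (replicate n [s, t])) = (s \<otimes> t) [^] n"
proof (induction n)
  case (Suc n)
  then show ?case using assms nat_pow_Suc2[of "s \<otimes> t" n] by (simp add: m_assoc)
qed simp

lemma inversions_alternating:
  assumes "s \<in> S" "t \<in> S"
  shows "inversions (concat (replicate n [s, t])) = map (\<lambda>i. (s \<otimes> t) [^] i \<otimes> s) [0..<2 * n]"
proof (induction n)
  case (Suc n)
  let ?r = "s \<otimes> t"
  \<comment> \<open>Prepending \<open>[s, t]\<close> conjugates the inversions by s t. As s inverts
    s t, this raises the exponent by two.\<close>
  have shift: "s \<otimes> (t \<otimes> (?r [^] i \<otimes> s) \<otimes> t) \<otimes> s = ?r [^] Suc (Suc i) \<otimes> s" for i :: nat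
  proof -
    have "s \<otimes> (t \<otimes> (?r [^] i \<otimes> s) \<otimes> t) \<otimes> s = (?r \<otimes> ?r [^] i) \<otimes> ?r \<otimes> s"
      using assms by (simp add: m_assoc)
    also have "?r \<otimes> ?r [^] i = ?r [^] Suc i"
      using assms by (metis S_carrier m_closed nat_pow_Suc2)
    finally show ?thesis by simp
  qed
  have "[0..<2 * Suc n] = 0 # 1 # map (\<lambda>i. Suc (Suc i)) [0..<2 * n]"
    by (simp add: upt_rec[of 0] map_Suc_upt[symmetric] flip: map_map[unfolded comp_def]
        del: upt_Suc)
  then show ?case
    using assms Suc by (simp add: shift del: upt_Suc nat_pow_Suc)
qed simp

text \<open>The list of all (s t)^i s with i < 2n is periodic with period n, so its two halves
  agree. For s t of infinite order the relator is the empty word.\<close>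

lemma even_count_relator:
  assumes "s \<in> S" "t \<in> S"
  shows "even (count_list (inversions (concat (replicate (ord (s \<otimes> t)) [s, t]))) r)"
proof -
  let ?n = "ord (s \<otimes> t)" and ?g = "\<lambda>i::nat. (s \<otimes> t) [^] i \<otimes> s"
  have "?g (i + ?n) = ?g i" for i
    using assms pow_ord_eq_1[of "s \<otimes> t"] by (simp add: nat_pow_mult[symmetric])
  then have "map ?g [?n..<2 * ?n] = map ?g [0..<?n]"
    by (intro nth_equalityI) (auto simp: add.commute)
  moreover have "[0..<2 * ?n] = [0..<?n] @ [?n..<2 * ?n]"
    by (metis upt_add_eq_append le0 mult_2)
  ultimately show ?thesis
    using inversions_alternating[OF assms, of ?n] by simp
qed

text \<open>An inserted relator has product 1, so it leaves the conjugations applied to the later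
  inversions unchanged; it only contributes its own inversions, each an even number of
  times.\<close>

lemma even_count_coxeter_eq:
  assumes "coxeter_eq (\<lambda>s t. ord (s \<otimes> t)) S u v" "r \<in> carrier W"
  shows "even (count_list (inversions u) r) = even (count_list (inversions v) r)"
  using assms
proof (induction rule: coxeter_eq.induct)
  case (rel u v s t)
  let ?p = "concat (replicate (ord (s \<otimes> t)) [s, t])"
  have p: "set ?p \<subseteq> S" using rel by (auto split: if_splits)
  have p1: "word_prod W ?p = \<one>"
    using rel word_prod_alternating pow_ord_eq_1[of "s \<otimes> t"] by simp
  have "set (u @ ?p) \<subseteq> S" using rel p by simp
  then have "inversions (u @ ?p @ v) = inversions (u @ ?p) @
      map (\<lambda>t. word_prod W (u @ ?p) \<otimes> t \<otimes> inv (word_prod W (u @ ?p))) (inversions v)"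
    using rel inversions_append[of "u @ ?p" v] by simp
  also have "word_prod W (u @ ?p) = word_prod W u"
    using rel p p1 by (simp add: word_prod_append)
  finally have "count_list (inversions (u @ ?p @ v)) r =
      count_list (inversions ?p) (inv (word_prod W u) \<otimes> r \<otimes> word_prod W u)
      + count_list (inversions (u @ v)) r"
    using rel p inversions_append[of u ?p] inversions_append[of u v]
    by (simp add: count_list_conj)
  then show ?case
    using even_count_relator[of s t] rel by simp
qed auto

text \<open>The assumption \<open>presentation\<close> enters here: it turns an invariant of words
  modulo relators into an invariant of their products.\<close>

lemma even_count_inversions:
  assumes "set u \<subseteq> S" "set v \<subseteq> S" "word_prod W u = word_prod W v" "r \<in> carrier W"
  shows "even (count_list (inversions u) r) = even (count_list (inversions v) r)"
  using even_count_coxeter_eq presentation assms by blast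

lemma inversion_delete:
  assumes "set u \<subseteq> S" "r \<in> set (inversions u)"
  shows "\<exists>a c b. u = a @ c # b \<and> r \<otimes> word_prod W u = word_prod W (a @ b)"
  using assms
proof (induction u arbitrary: r)
  case (Cons s u)
  show ?case
  proof (cases "r = s")
    case True
    then show ?thesis using Cons by (intro exI[of _ "[]"] exI[of _ s] exI[of _ u]) auto
  next
    case False
    then obtain r' where r': "r' \<in> set (inversions u)" "r = s \<otimes> r' \<otimes> s" using Cons by auto
    then obtain a c b where u: "u = a @ c # b" "r' \<otimes> word_prod W u = word_prod W (a @ b)"
      using Cons.IH[of r'] Cons.prems by auto
    have c: "r' \<in> carrier W" using r' Cons.prems inversions_carrier[of u] by fastforce
    have "r \<otimes> word_prod W (s # u) = s \<otimes> (r' \<otimes> word_prod W u)"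
      using Cons.prems c r' by (simp add: m_assoc)
    then show ?thesis using u by (intro exI[of _ "s # a"] exI[of _ c] exI[of _ b]) auto
  qed
qed simp

section \<open>Length, exchange and deletion\<close>

lemma len_le: "set u \<subseteq> S \<Longrightarrow> len (word_prod W u) \<le> length u"
  unfolding len_def by (rule Least_le) blast

lemma reduced_word:
  assumes "w \<in> carrier W"
  obtains u where "set u \<subseteq> S" "length u = len w" "word_prod W u = w"
proof -
  have "\<exists>n u. set u \<subseteq> S \<and> length u = n \<and> word_prod W u = w"
    using words_exist[OF assms] by metis
  then show ?thesis
    using LeastI_ex[of "\<lambda>n. \<exists>u. set u \<subseteq> S \<and> length u = n \<and> word_prod W u = w"] that
    unfolding len_def by blast
qed

lemma len_one [simp]: "len \<one> = 0"
  using len_le[of "[]"] by simp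

lemma len_eq_0: "w \<in> carrier W \<Longrightarrow> len w = 0 \<longleftrightarrow> w = \<one>"
  by (metis reduced_word length_0_conv word_prod_Nil len_one)

lemma len_S [simp]: "s \<in> S \<Longrightarrow> len s = 1"
  using len_le[of "[s]"] len_eq_0[of s] one_notin_S by (auto simp: le_Suc_eq)

lemma len_1_in_S:
  assumes "w \<in> carrier W" "len w = 1"
  shows "w \<in> S"
proof -
  obtain u where "set u \<subseteq> S" "length u = 1" "word_prod W u = w"
    using reduced_word assms by metis
  then show ?thesis by (cases u) auto
qed

text \<open>Take a reduced word v for s u. If s were an inversion of v, deleting a letter would make
  u shorter than v, against the length hypothesis. So s occurs exactly once among the inversions of
  \<open>s # v\<close>, a word with the same product as u, and by parity it occurs among those of u.
  The word u need not be reduced.\<close>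

lemma exchange:
  assumes "s \<in> S" "set u \<subseteq> S" "len (s \<otimes> word_prod W u) \<le> len (word_prod W u)"
  shows "\<exists>a c b. u = a @ c # b \<and> s \<otimes> word_prod W u = word_prod W (a @ b)"
proof -
  obtain v where v: "set v \<subseteq> S" "length v = len (s \<otimes> word_prod W u)"
    "word_prod W v = s \<otimes> word_prod W u"
    using reduced_word assms by (metis S_carrier m_closed word_prod_closed)
  have "s \<notin> set (inversions v)"
  proof
    assume "s \<in> set (inversions v)"
    then obtain a c b where ab: "v = a @ c # b" "s \<otimes> word_prod W v = word_prod W (a @ b)"
      using inversion_delete v by blast
    then have "word_prod W u = word_prod W (a @ b)" using v assms by simp
    then have "len (word_prod W u) < length v" using len_le[of "a @ b"] ab v by auto
    then show False using v assms by simp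
  qed
  moreover have "count_list (map (\<lambda>x. s \<otimes> x \<otimes> inv s) (inversions v)) s
      = count_list (inversions v) (inv s \<otimes> s \<otimes> s)"
    using assms v by (intro count_list_conj) auto
  ultimately have "count_list (inversions (s # v)) s = 1"
    using assms by simp
  moreover have "even (count_list (inversions (s # v)) s) = even (count_list (inversions u) s)"
    using assms v by (intro even_count_inversions) auto
  ultimately have "s \<in> set (inversions u)"
    by (metis count_list_0_iff odd_one even_zero)
  then show ?thesis using inversion_delete assms by blast
qed

lemma len_mult_S:
  assumes "s \<in> S" "w \<in> carrier W"
  shows "len (s \<otimes> w) = len w + 1 \<or> len w = len (s \<otimes> w) + 1"
proof -
  have le: "len (s \<otimes> x) \<le> len x + 1" if "x \<in> carrier W" for x
    using reduced_word[OF that] len_le[of "s # _"] assms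
    by (metis Suc_eq_plus1 insert_subset length_Cons list.simps(15) word_prod_Cons)
  obtain u where u: "set u \<subseteq> S" "length u = len w" "word_prod W u = w"
    using reduced_word assms by blast
  have "len (s \<otimes> w) < len w" if small: "len (s \<otimes> w) \<le> len w"
  proof -
    obtain a c b where "u = a @ c # b" "s \<otimes> w = word_prod W (a @ b)"
      using exchange[of s u] small u assms by auto
    then show ?thesis using len_le[of "a @ b"] u by auto
  qed
  then show ?thesis
    using le[of w] le[of "s \<otimes> w"] assms by force
qed

lemma len_inv [simp]:
  assumes "w \<in> carrier W"
  shows "len (inv w) = len w"
proof -
  have "len (inv x) \<le> len x" if "x \<in> carrier W" for x
    using reduced_word[OF that] len_le[of "rev _"] by (metis length_rev set_rev word_prod_rev)
  from this[of w] this[of "inv w"] show ?thesis using assms by simp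
qed

lemma len_mult_S_right:
  assumes "s \<in> S" "w \<in> carrier W"
  shows "len (w \<otimes> s) = len w + 1 \<or> len w = len (w \<otimes> s) + 1"
  using len_mult_S[of s "inv w"] len_inv[of "w \<otimes> s"] len_inv[of w] assms
  by (simp add: inv_mult_group)

lemma len_mult_le:
  assumes "x \<in> carrier W" "y \<in> carrier W"
  shows "len (x \<otimes> y) \<le> len x + len y"
proof -
  obtain u v where "set u \<subseteq> S" "length u = len x" "word_prod W u = x"
    "set v \<subseteq> S" "length v = len y" "word_prod W v = y"
    using reduced_word assms by metis
  then show ?thesis using len_le[of "u @ v"] by (auto simp: word_prod_append)
qed

lemma even_len_word: "set u \<subseteq> S \<Longrightarrow> even (len (word_prod W u)) = even (length u)"
proof (induction u)
  case (Cons s u)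
  then show ?case using len_mult_S[of s "word_prod W u"] by auto
qed simp

lemma even_len_mult:
  assumes "x \<in> carrier W" "y \<in> carrier W"
  shows "even (len (x \<otimes> y)) = even (len x + len y)"
proof -
  obtain u v where "set u \<subseteq> S" "length u = len x" "word_prod W u = x"
    "set v \<subseteq> S" "length v = len y" "word_prod W v = y"
    using reduced_word assms by metis
  then show ?thesis using even_len_word[of "u @ v"] by (auto simp: word_prod_append)
qed

text \<open>The deletion property, by adding letters on the left: a letter that does not lengthen
  the product is dropped together with the letter that \<open>exchange\<close> removes.\<close>

lemma reduced_subword:
  assumes "set u \<subseteq> S"
  shows "\<exists>v. subseq v u \<and> length v = len (word_prod W u) \<and> word_prod W v = word_prod W u"
  using assms
proof (induction u)
  case (Cons s u)
  then obtain v where v: "subseq v u" "length v = len (word_prod W u)"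
    "word_prod W v = word_prod W u" by auto
  have vS: "set v \<subseteq> S" using subseq_set[OF v(1)] Cons.prems by auto
  have s: "s \<in> S" "word_prod W u \<in> carrier W" using Cons.prems by auto
  show ?case
  proof (cases "len (s \<otimes> word_prod W u) = len (word_prod W u) + 1")
    case True
    then show ?thesis using v by (intro exI[of _ "s # v"]) auto
  next
    case False
    then have l: "len (word_prod W u) = len (s \<otimes> word_prod W u) + 1"
      using len_mult_S s by blast
    then obtain a c b where ab: "v = a @ c # b" "s \<otimes> word_prod W v = word_prod W (a @ b)"
      using exchange[of s v] v vS s by auto
    have "subseq (a @ b) v"
      unfolding ab(1) by (intro list_emb_append_mono) auto
    then have "subseq (a @ b) (s # u)"
      using v(1) subseq_order.trans by (intro list_emb_Cons) blast
    moreover have "length (a @ b) = len (s \<otimes> word_prod W u)"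
      using v(2) l ab(1) by simp
    ultimately show ?thesis using v(3) ab(2) by (intro exI[of _ "a @ b"]) simp
  qed
qed auto

section \<open>Standard parabolic subgroups\<close>

lemma parabolic_reduced_word:
  assumes "K \<subseteq> S" "x \<in> generate W K"
  obtains u where "set u \<subseteq> K" "length u = len x" "word_prod W u = x"
proof -
  obtain v where v: "set v \<subseteq> K" "word_prod W v = x"
    using generate_words assms by blast
  then obtain u where "subseq u v" "length u = len x" "word_prod W u = x"
    using reduced_subword[of v] assms(1) by auto
  then show ?thesis using that subseq_set v by blast
qed

lemma S_in_parabolic:
  assumes "K \<subseteq> S" "s \<in> S" "s \<in> generate W K"
  shows "s \<in> K"
proof -
  obtain u where u: "set u \<subseteq> K" "length u = len s" "word_prod W u = s"
    using parabolic_reduced_word assms by blast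
  then obtain k where "u = [k]" using assms by (auto simp: length_Suc_conv)
  then show ?thesis using u assms by auto
qed

lemma parabolic_mult:
  "K \<subseteq> S \<Longrightarrow> x \<in> generate W K \<Longrightarrow> y \<in> generate W K \<Longrightarrow> x \<otimes> y \<in> generate W K"
  by (rule generate.eng)

text \<open>Exchange in a reduced word over \<open>K\<close> puts s x into the parabolic subgroup,
  hence also s = (s x) x^(-1).\<close>

lemma parabolic_descent:
  assumes "K \<subseteq> S" "x \<in> generate W K" "s \<in> S" "len (s \<otimes> x) < len x"
  shows "s \<in> K"
proof -
  obtain u where u: "set u \<subseteq> K" "length u = len x" "word_prod W u = x"
    using parabolic_reduced_word assms by blast
  moreover have "set u \<subseteq> S" using u assms by blast
  ultimately obtain a c b where ab: "u = a @ c # b" "s \<otimes> x = word_prod W (a @ b)"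
    using exchange[of s u] assms by auto
  have x: "x \<in> carrier W" using generate_carrier assms by blast
  have "s \<otimes> x \<in> generate W K"
    unfolding ab(2) using u ab(1) assms(1) by (intro generate_wordI) auto
  then have "s \<otimes> x \<otimes> inv x \<in> generate W K"
    using parabolic_mult generate_inv assms by blast
  moreover have "s \<otimes> x \<otimes> inv x = s"
    using assms x by (simp add: m_assoc)
  ultimately show ?thesis using S_in_parabolic assms by simp
qed

lemma parabolic_descent_right:
  assumes "K \<subseteq> S" "x \<in> generate W K" "s \<in> S" "len (x \<otimes> s) < len x"
  shows "s \<in> K"
proof -
  have "x \<in> carrier W" using generate_carrier assms by blast
  then have "len (s \<otimes> inv x) < len (inv x)"
    using assms len_inv[of "x \<otimes> s"] by (simp add: inv_mult_group)
  then show ?thesis using parabolic_descent generate_inv assms by blast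
qed

text \<open>The first letter of a reduced word is a left descent, hence lies in \<open>K\<close>;
  strip it and continue.\<close>

lemma parabolic_reduced_letters:
  assumes "K \<subseteq> S" "word_prod W u \<in> generate W K" "set u \<subseteq> S" "length u = len (word_prod W u)"
  shows "set u \<subseteq> K"
  using assms
proof (induction u)
  case (Cons s u)
  have c: "s \<in> S" "word_prod W u \<in> carrier W" using Cons.prems by auto
  have l: "length u = len (word_prod W u)" "len (word_prod W u) < len (s \<otimes> word_prod W u)"
    using len_mult_S[of s "word_prod W u"] len_le[of u] Cons.prems by auto
  then have s: "s \<in> K"
    using parabolic_descent[of K "s \<otimes> word_prod W u" s] Cons.prems c by simp
  then have "s \<in> generate W K" by (rule generate.incl)
  then have "s \<otimes> word_prod W (s # u) \<in> generate W K"
    using parabolic_mult Cons.prems by blast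
  then show ?case using Cons l c s by simp
qed simp

lemma parabolic_Int:
  assumes "K \<subseteq> S" "L \<subseteq> S" "x \<in> generate W K" "x \<in> generate W L"
  shows "x \<in> generate W (K \<inter> L)"
proof -
  obtain u where u: "set u \<subseteq> K" "length u = len x" "word_prod W u = x"
    using parabolic_reduced_word assms by blast
  then have "set u \<subseteq> L" using parabolic_reduced_letters[of L u] assms by auto
  then show ?thesis using u assms generate_wordI[of "K \<inter> L" u] by auto
qed

text \<open>Write u as a^(-1) (a u b) b^(-1), with words over \<open>K\<close> and \<open>L\<close>
  for the outer factors and a reduced word for the middle one, and extract a reduced subword for u.
  It takes no letter from the outer words, since its first or last letter would then be a forbidden
  descent of u. So u has a reduced word that is a subword of one for a u b.\<close>

lemma minimal_in_double_coset:
  assumes K: "K \<subseteq> S" "L \<subseteq> S" and u: "u \<in> carrier W"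
    and left: "\<And>k. k \<in> K \<Longrightarrow> len u < len (k \<otimes> u)"
    and right: "\<And>l. l \<in> L \<Longrightarrow> len u < len (u \<otimes> l)"
    and ab: "a \<in> generate W K" "b \<in> generate W L"
  shows "len u \<le> len (a \<otimes> u \<otimes> b)"
    and "len (a \<otimes> u \<otimes> b) = len u \<Longrightarrow> a \<otimes> u \<otimes> b = u"
proof -
  have c: "a \<in> carrier W" "b \<in> carrier W" using generate_carrier K ab by blast+
  obtain wa where wa: "set wa \<subseteq> K" "word_prod W wa = inv a"
    using generate_words[of K "inv a"] generate_inv K ab by blast
  obtain wb where wb: "set wb \<subseteq> L" "word_prod W wb = inv b"
    using generate_words[of L "inv b"] generate_inv K ab by blast
  obtain wv where wv: "set wv \<subseteq> S" "length wv = len (a \<otimes> u \<otimes> b)" "word_prod W wv = a \<otimes> u \<otimes> b"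
    using reduced_word c u by (metis m_closed)
  have "word_prod W (wa @ wv @ wb) = inv a \<otimes> (a \<otimes> u \<otimes> b \<otimes> inv b)"
    using wa wb wv K by (subst word_prod_append word_prod_append; auto)+
  also have "\<dots> = u" using c u by (simp add: m_assoc)
  finally have prod: "word_prod W (wa @ wv @ wb) = u" .
  have S: "set (wa @ wv @ wb) \<subseteq> S" using wa wb wv K by auto
  obtain v where v: "subseq v (wa @ wv @ wb)" "length v = len u" "word_prod W v = u"
    using reduced_subword[OF S] prod by auto
  obtain v1 v23 where v1: "v = v1 @ v23" "subseq v1 wa" "subseq v23 (wv @ wb)"
    using v(1) by (auto simp: subseq_append_iff)
  then obtain v2 v3 where v3: "v23 = v2 @ v3" "subseq v2 wv" "subseq v3 wb"
    by (auto simp: subseq_append_iff)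
  have vS: "set v \<subseteq> S" using subseq_set[OF v(1)] S by blast
  have "v1 = []"
  proof (cases v1)
    case (Cons k v')
    have "k \<in> K" using Cons subseq_set[OF v1(2)] wa by auto
    then have k: "k \<in> K" "k \<in> S" using K by auto
    then have "k \<otimes> u = word_prod W (v' @ v23)"
      using v Cons v1(1) vS by auto
    then have "len (k \<otimes> u) < len u"
      using len_le[of "v' @ v23"] v Cons v1(1) vS by auto
    then show ?thesis using left k by fastforce
  qed
  moreover have "v3 = []"
  proof (cases v3 rule: rev_cases)
    case (snoc v' l)
    have "l \<in> L" using snoc subseq_set[OF v3(3)] wb by auto
    then have l: "l \<in> L" "l \<in> S" using K by auto
    have v': "v = (v1 @ v2 @ v') @ [l]" "set (v1 @ v2 @ v') \<subseteq> S" using snoc v3 v1 vS by auto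
    then have "u = word_prod W (v1 @ v2 @ v') \<otimes> l"
      using v(3) l word_prod_append[of "v1 @ v2 @ v'" "[l]"] by simp
    then have "u \<otimes> l = word_prod W (v1 @ v2 @ v')"
      using l v' by simp
    then have "len (u \<otimes> l) < len u"
      using len_le[of "v1 @ v2 @ v'"] v v' by auto
    then show ?thesis using right l by fastforce
  qed
  ultimately have sub: "subseq v wv" using v1 v3 by simp
  then show "len u \<le> len (a \<otimes> u \<otimes> b)"
    using v wv list_emb_length by metis
  assume "len (a \<otimes> u \<otimes> b) = len u"
  then have "v = wv" using subseq_same_length sub v wv by metis
  then show "a \<otimes> u \<otimes> b = u" using v wv by simp
qed

text \<open>Apply \<open>exchange\<close> to the concatenation of reduced words for x and y. The
  deleted letter cannot come from x, as s lengthens x; hence it comes from y, and what remains of y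
  is still a word over \<open>L\<close>.\<close>

lemma exchange_mult:
  assumes "s \<in> S" "x \<in> carrier W" "L \<subseteq> S" "y \<in> generate W L"
    and "len (s \<otimes> (x \<otimes> y)) < len (x \<otimes> y)" "len x < len (s \<otimes> x)"
  shows "\<exists>y'\<in>generate W L. len y' < len y \<and> s \<otimes> (x \<otimes> y) = x \<otimes> y'"
proof -
  obtain u where u: "set u \<subseteq> S" "length u = len x" "word_prod W u = x"
    using reduced_word assms by blast
  obtain v where v: "set v \<subseteq> L" "length v = len y" "word_prod W v = y"
    using parabolic_reduced_word assms by blast
  have vS: "set v \<subseteq> S" using v assms by auto
  have xy: "word_prod W (u @ v) = x \<otimes> y" using word_prod_append u v vS by simp
  then obtain a c b where ab: "u @ v = a @ c # b" "s \<otimes> (x \<otimes> y) = word_prod W (a @ b)"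
    using exchange[of s "u @ v"] assms u vS by auto
  from ab(1) consider e where "u = a @ c # e" "b = e @ v" | e where "a = u @ e" "v = e @ c # b"
    by (auto simp: append_eq_append_conv2 append_eq_Cons_conv)
  then show ?thesis
  proof cases
    case 1
    have e: "set (a @ e) \<subseteq> S" using 1 u by auto
    have "s \<otimes> (x \<otimes> y) = word_prod W (a @ e) \<otimes> y"
      using ab 1 e v vS word_prod_append[of "a @ e" v] by simp
    then have "(s \<otimes> x) \<otimes> y = word_prod W (a @ e) \<otimes> y"
      using assms generate_carrier[of L y] by (simp add: m_assoc)
    then have "s \<otimes> x = word_prod W (a @ e)"
      using assms generate_carrier[of L y] word_prod_closed[OF e] by simp
    then have "len (s \<otimes> x) < len x" using len_le[OF e] 1 u by simp
    then show ?thesis using assms by simp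
  next
    case 2
    then have "word_prod W (e @ b) \<in> generate W L"
      using v assms by (intro generate_wordI) auto
    moreover have "len (word_prod W (e @ b)) < len y"
      using len_le[of "e @ b"] 2 v vS by auto
    moreover have "s \<otimes> (x \<otimes> y) = x \<otimes> word_prod W (e @ b)"
      using ab 2 u vS word_prod_append[of u "e @ b"] by simp
    ultimately show ?thesis by blast
  qed
qed

text \<open>Add the letters of a reduced word for y one at a time. If some k shortened y u,
  \<open>exchange_mult\<close> would give k y u = y u' with u' shorter than u. But u' = (y^(-1) k y)
  u lies in the coset of which u is a shortest element.\<close>

lemma parabolic_len_add:
  assumes K: "K \<subseteq> S" and u: "u \<in> carrier W"
    and left: "\<And>k. k \<in> K \<Longrightarrow> len u < len (k \<otimes> u)"
    and y: "y \<in> generate W K"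
  shows "len (y \<otimes> u) = len y + len u"
proof -
  have "len (word_prod W w \<otimes> u) = length w + len u"
    if "set w \<subseteq> K" "length w = len (word_prod W w)" for w
    using that
  proof (induction w)
    case (Cons k w)
    let ?y = "word_prod W w"
    have c: "k \<in> S" "k \<in> K" "set w \<subseteq> S" "?y \<in> carrier W" using Cons.prems K by auto
    have l: "length w = len ?y" "len ?y < len (k \<otimes> ?y)"
      using len_mult_S[of k ?y] len_le[of w] Cons.prems c by auto
    then have IH: "len (?y \<otimes> u) = length w + len u" using Cons by simp
    have "\<not> len (k \<otimes> (?y \<otimes> u)) < len (?y \<otimes> u)"
    proof
      assume less: "len (k \<otimes> (?y \<otimes> u)) < len (?y \<otimes> u)"
      have "u \<in> generate W S" using u generates by simp
      then obtain u' where u': "u' \<in> generate W S" "len u' < len u"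
        "k \<otimes> (?y \<otimes> u) = ?y \<otimes> u'"
        using exchange_mult[of k ?y S u] less c l by auto
      have c': "u' \<in> carrier W" using u' generates by simp
      have "inv ?y \<otimes> (k \<otimes> (?y \<otimes> u)) = u'" unfolding u'(3) using c c' by simp
      then have "u' = (inv ?y \<otimes> k \<otimes> ?y) \<otimes> u \<otimes> \<one>" using c c' u by (simp add: m_assoc)
      moreover have "?y \<in> generate W K" using Cons.prems K generate_wordI by simp
      then have "inv ?y \<otimes> k \<otimes> ?y \<in> generate W K"
        using c K generate_inv generate.incl[of k K] by (intro parabolic_mult) auto
      ultimately have "len u \<le> len u'"
        using minimal_in_double_coset(1)[of K "{}" u "inv ?y \<otimes> k \<otimes> ?y" \<one>] K u left
        by (auto intro: generate.one)
      then show False using u' by simp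
    qed
    then have "len (k \<otimes> (?y \<otimes> u)) = len (?y \<otimes> u) + 1"
      using len_mult_S[of k "?y \<otimes> u"] c u by auto
    then show ?case using c u IH by (simp add: m_assoc)
  qed (use u in simp)
  then show ?thesis using parabolic_reduced_word K y by metis
qed

lemma parabolic_len_add_right:
  assumes K: "K \<subseteq> S" and u: "u \<in> carrier W"
    and right: "\<And>k. k \<in> K \<Longrightarrow> len u < len (u \<otimes> k)"
    and y: "y \<in> generate W K"
  shows "len (u \<otimes> y) = len u + len y"
proof -
  have c: "y \<in> carrier W" using generate_carrier K y by blast
  have "len (inv u) < len (k \<otimes> inv u)" if "k \<in> K" for k
    using right[OF that] that subsetD[OF K that] u len_inv[of "u \<otimes> k"] by (simp add: inv_mult_group)
  then have "len (inv y \<otimes> inv u) = len (inv y) + len (inv u)"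
    using parabolic_len_add[of K "inv u" "inv y"] K u y generate_inv by blast
  then show ?thesis using u c len_inv[of "u \<otimes> y"] by (simp add: inv_mult_group)
qed

text \<open>When s shortens u t but lengthens u, the letter exchanged can only be t, so s u t =
  u.\<close>

lemma commute_of_len:
  assumes "s \<in> S" "t \<in> S" "u \<in> carrier W"
    and "len u < len (s \<otimes> u)" "len u < len (u \<otimes> t)" "len (s \<otimes> (u \<otimes> t)) \<le> len u"
  shows "s \<otimes> u = u \<otimes> t"
proof -
  have "t \<in> generate W {t}" by (rule generate.incl) simp
  then obtain y where y: "y \<in> generate W {t}" "len y < len t" "s \<otimes> (u \<otimes> t) = u \<otimes> y"
    using exchange_mult[of s u "{t}" t] assms by auto
  have "y \<in> carrier W" using y assms generate_carrier[of "{t}"] by blast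
  then have "y = \<one>" using y assms len_eq_0 by simp
  then have "s \<otimes> u \<otimes> t = u" using y assms by (simp add: m_assoc)
  then have "u \<otimes> t = s \<otimes> u \<otimes> t \<otimes> t" by simp
  then show ?thesis using assms by simp
qed

section \<open>First and last letters in parabolic and dihedral subgroups\<close>

lemma parabolic_last:
  assumes "K \<subseteq> S" "x \<in> generate W K" "x \<noteq> \<one>"
  obtains y r where "r \<in> K" "y \<in> generate W K" "x = y \<otimes> r" "len x = len y + 1"
proof -
  obtain u where u: "set u \<subseteq> K" "length u = len x" "word_prod W u = x"
    using parabolic_reduced_word assms by blast
  obtain v r where v: "u = v @ [r]"
    using u assms(3) by (cases u rule: rev_cases) auto
  have S: "set v \<subseteq> S" "r \<in> S" "set v \<subseteq> K" "r \<in> K" using u v assms by auto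
  have x: "x = word_prod W v \<otimes> r" using u v S word_prod_append[of v "[r]"] by simp
  moreover have "len x = len (word_prod W v) + 1"
    using len_mult_S_right[of r "word_prod W v"] len_le[of v] x u v S by auto
  moreover have "word_prod W v \<in> generate W K" using generate_wordI S assms(1) by blast
  ultimately show ?thesis using that S(4) by blast
qed

lemma parabolic_first_descent:
  assumes "K \<subseteq> S" "x \<in> generate W K" "x \<noteq> \<one>"
  shows "\<exists>k\<in>K. len (k \<otimes> x) < len x"
proof -
  have x: "x \<in> carrier W" using generate_carrier assms by blast
  have "inv x \<in> generate W K" "inv x \<noteq> \<one>" using generate_inv assms x by auto
  then obtain y r where r: "r \<in> K" "y \<in> generate W K" "inv x = y \<otimes> r" "len (inv x) = len y + 1"
    using parabolic_last assms(1) by metis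
  have S: "r \<in> S" "y \<in> carrier W" using r assms generate_carrier by blast+
  have "x = inv (y \<otimes> r)" using r(3) x by (metis inv_inv)
  then have "r \<otimes> x = inv y" using S by (simp add: inv_mult_group)
  then have "len (r \<otimes> x) = len y" using S by simp
  moreover have "len x = len y + 1" using r(4) x by simp
  ultimately have "len (r \<otimes> x) < len x" by simp
  then show ?thesis using r by blast
qed

text \<open>
  In the dihedral group \<open>generate W {s, t}\<close>, \<open>q\<close> is the longest element and \<open>x\<close> the alternating
  word of length one less that starts with \<open>s\<close>.
\<close>

lemma dihedral_predecessor:
  assumes st: "s \<in> S" "t \<in> S" "s \<noteq> t" and q: "q \<in> generate W {s, t}" "len (s \<otimes> q) < len q" "len (t \<otimes> q) < len q"
    and min: "\<And>x. \<lbrakk>x \<in> generate W {s, t}; len (s \<otimes> x) < len x; len (t \<otimes> x) < len x\<rbrakk> \<Longrightarrow> len q \<le> len x"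
  obtains x r where "r \<in> {s, t}" "x \<in> generate W {s, t}" "q = x \<otimes> r" "len q = len x + 1"
    "len (s \<otimes> x) < len x" "len x < len (t \<otimes> x)"
proof -
  have K: "{s, t} \<subseteq> S" using st by simp
  have s: "s \<in> generate W {s, t}" by (rule generate.incl) simp
  have cq: "q \<in> carrier W" using generate_carrier K q by blast
  have q': "s \<otimes> q \<in> generate W {s, t}" using parabolic_mult K s q by blast
  have lq: "len q = len (s \<otimes> q) + 1" using len_mult_S[of s q] st cq q by linarith
  \<comment> \<open>Otherwise q = s, and the descent t would force t s = 1, that is t = s.\<close>
  have "s \<otimes> q \<noteq> \<one>"
  proof
    assume "s \<otimes> q = \<one>"
    then have "s \<otimes> (s \<otimes> q) = s" using st by simp
    then have "q = s" using st cq by simp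
    then have "len (t \<otimes> s) = 0" using q st by simp
    then have "t \<otimes> s = \<one>" using len_eq_0[of "t \<otimes> s"] st by simp
    then have "t = inv s" using st by (metis S_carrier inv_equality)
    then show False using st by simp
  qed
  then obtain y r where r: "r \<in> {s, t}" "y \<in> generate W {s, t}" "s \<otimes> q = y \<otimes> r" "len (s \<otimes> q) = len y + 1"
    using parabolic_last K q' by metis
  have c: "r \<in> S" "y \<in> carrier W" using r K generate_carrier by blast+
  let ?x = "s \<otimes> y"
  have x: "?x \<in> generate W {s, t}" using parabolic_mult K s r by blast
  have "q = s \<otimes> (s \<otimes> q)" using st cq by simp
  then have qx: "q = ?x \<otimes> r" unfolding r(3) using c st by (simp add: m_assoc)
  have "len q \<le> len ?x + 1"
    using len_mult_S_right[of r ?x] qx c st by auto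
  moreover have "len ?x = len y + 1 \<or> len y = len ?x + 1" using len_mult_S[of s y] c st by blast
  ultimately have lx: "len q = len ?x + 1" "len ?x = len y + 1" using lq r(4) by linarith+
  have sx: "len (s \<otimes> ?x) < len ?x" using lx c st by simp
  have "\<not> len (t \<otimes> ?x) < len ?x" using min[OF x sx] lx by linarith
  then have "len ?x < len (t \<otimes> ?x)" using len_mult_S[of t ?x] c st by fastforce
  then show ?thesis using that[OF r(1) x qx lx(1) sx] by blast
qed

section \<open>The longest element\<close>

text \<open>Every x is a prefix of an element w of maximal length. Inductively let w = x v and let s
  lengthen x. By maximality s shortens w, and the exchange must take a letter from v, so w = (s x)
  v' with v' shorter. The lemma speaks of any w of maximal length because uniqueness of
  \<open>longest\<close> is derived from it.\<close>

lemma longest_factor: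
  assumes w: "w \<in> carrier W" and max: "\<And>v. v \<in> carrier W \<Longrightarrow> len v \<le> len w"
    and "x \<in> carrier W"
  shows "len w = len x + len (inv x \<otimes> w)"
proof -
  have "len w = length u + len (inv (word_prod W u) \<otimes> w)"
    if "set u \<subseteq> S" "length u = len (word_prod W u)" for u
    using that
  proof (induction u)
    case Nil
    then show ?case using w by simp
  next
    case (Cons s u)
    let ?x = "word_prod W u" and ?v = "inv (word_prod W u) \<otimes> w"
    have c: "s \<in> S" "?x \<in> carrier W" "?v \<in> carrier W" using Cons.prems w by auto
    have l: "length u = len ?x" "len ?x < len (s \<otimes> ?x)"
      using len_mult_S[of s ?x] len_le[of u] Cons.prems c by auto
    then have IH: "len w = len ?x + len ?v" using Cons by simp
    have wx: "?x \<otimes> ?v = w" using c w by simp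
    have "len (s \<otimes> w) < len w"
      using len_mult_S[of s w] max[of "s \<otimes> w"] c w by auto
    then obtain v' where v': "v' \<in> carrier W" "len v' < len ?v" "s \<otimes> w = ?x \<otimes> v'"
      using exchange_mult[of s ?x S ?v] c l generates by (auto simp: wx)
    have "w = s \<otimes> (s \<otimes> w)" using c w by simp
    also have "\<dots> = (s \<otimes> ?x) \<otimes> v'" unfolding v'(3) using c v' by (simp add: m_assoc)
    finally have ww: "w = (s \<otimes> ?x) \<otimes> v'" .
    then have "inv (s \<otimes> ?x) \<otimes> w = v'" using c v' by simp
    moreover have "len w \<le> len (s \<otimes> ?x) + len v'"
      using ww len_mult_le[of "s \<otimes> ?x" v'] c v' by simp
    ultimately show ?case using IH v' l Cons.prems by simp
  qed
  then show ?thesis using reduced_word[OF assms(3)] by metis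
qed

context
  assumes spherical: spherical_type
begin

text \<open>Finiteness gives an element of maximal length. Of two such elements one is a prefix of
  the other by \<open>longest_factor\<close>, with a remainder of length 0, so the description in
  \<open>longest\<close> is proper.\<close>

lemma longest_props: "longest \<in> carrier W" "\<And>v. v \<in> carrier W \<Longrightarrow> len v \<le> len longest"
proof -
  let ?P = "\<lambda>w. w \<in> carrier W \<and> (\<forall>v\<in>carrier W. len v \<le> len w)"
  have fin: "finite (len ` carrier W)" "len ` carrier W \<noteq> {}"
    using spherical unfolding spherical_type_def by auto
  then have "Max (len ` carrier W) \<in> len ` carrier W" by (rule Max_in)
  then obtain w where w: "w \<in> carrier W" "len w = Max (len ` carrier W)" by auto
  then have wP: "?P w" using fin by auto
  have "w' = w" if "?P w'" for w'
  proof -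
    have "len w = len w' + len (inv w' \<otimes> w)" using longest_factor[of w w'] wP that by blast
    moreover have "len w = len w'" using wP that by (simp add: le_antisym)
    ultimately have "inv w' \<otimes> w = \<one>" using len_eq_0[of "inv w' \<otimes> w"] wP that by simp
    then have "w' \<otimes> (inv w' \<otimes> w) = w'" using that by simp
    then show ?thesis using wP that by simp
  qed
  with wP have "?P longest" unfolding longest_def by (rule theI)
  then show "longest \<in> carrier W" "\<And>v. v \<in> carrier W \<Longrightarrow> len v \<le> len longest" by auto
qed

lemma len_mult_longest:
  assumes "x \<in> carrier W"
  shows "len longest = len x + len (x \<otimes> longest)"
  using longest_factor[of longest "inv x"] longest_props assms by simp

lemma inv_longest [simp]: "inv longest = longest"
proof -
  have "len longest = len longest + len (longest \<otimes> longest)"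
    using len_mult_longest longest_props by blast
  then have "longest \<otimes> longest = \<one>" using len_eq_0[of "longest \<otimes> longest"] longest_props by simp
  then show ?thesis using longest_props by (simp add: inv_equality)
qed

lemma longest_sq [simp]: "longest \<otimes> longest = \<one>"
  using l_inv[of longest] longest_props by simp

lemma longest_cancel [simp]: "y \<in> carrier W \<Longrightarrow> longest \<otimes> (longest \<otimes> y) = y"
  using inv_cancel(2)[of longest y] longest_props by simp

lemma len_longest_mult:
  assumes "x \<in> carrier W"
  shows "len longest = len x + len (longest \<otimes> x)"
  using len_mult_longest[of "inv x"] len_inv[of "longest \<otimes> x"] longest_props assms
  by (simp add: inv_mult_group)

text \<open>Multiplication by \<open>longest\<close> on either side replaces a length by its
  complement; doing both restores length 1.\<close>

lemma longest_conj_S: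
  assumes "t \<in> S"
  shows "longest \<otimes> t \<otimes> longest \<in> S"
proof -
  have "len longest = len t + len (longest \<otimes> t)"
    using len_longest_mult[of t] assms by simp
  moreover have "len longest = len (longest \<otimes> t) + len (longest \<otimes> t \<otimes> longest)"
    using len_mult_longest[of "longest \<otimes> t"] longest_props assms by simp
  ultimately have "len (longest \<otimes> t \<otimes> longest) = 1" using assms by simp
  then show ?thesis using longest_props(1) assms by (intro len_1_in_S) auto
qed

text \<open>Put t' = w t w with w = \<open>longest\<close>. Right multiplication by w reverses
  lengths, so an ascent of x w by two is a descent from x to s x t' by two. Both s and t' are then
  descents inside the parabolic subgroup, hence members of \<open>K\<close>.\<close>

lemma ascent_parabolic_longest:
  assumes K: "K \<subseteq> S" "x \<in> generate W K" and st: "s \<in> S" "t \<in> S"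
    and up: "len (s \<otimes> (x \<otimes> longest) \<otimes> t) = len (x \<otimes> longest) + 2"
  shows "\<exists>y\<in>generate W K. s \<otimes> (x \<otimes> longest) \<otimes> t = y \<otimes> longest"
proof -
  let ?t = "longest \<otimes> t \<otimes> longest"
  have c: "x \<in> carrier W" "?t \<in> S" "longest \<in> carrier W"
    using generate_carrier K longest_conj_S st longest_props by blast+
  have eq: "s \<otimes> (x \<otimes> longest) \<otimes> t = s \<otimes> x \<otimes> ?t \<otimes> longest"
    using c st by (simp add: m_assoc)
  have "len longest = len (s \<otimes> x \<otimes> ?t) + len (s \<otimes> x \<otimes> ?t \<otimes> longest)"
    using len_mult_longest c st S_carrier by (metis m_closed)
  moreover have "len longest = len x + len (x \<otimes> longest)"
    using len_mult_longest c by blast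
  ultimately have l: "len (s \<otimes> x \<otimes> ?t) + 2 = len x" using up unfolding eq by simp
  have r: "len (s \<otimes> x \<otimes> ?t) = len (s \<otimes> x) + 1 \<or> len (s \<otimes> x) = len (s \<otimes> x \<otimes> ?t) + 1"
    using len_mult_S_right[of ?t "s \<otimes> x"] c st by simp
  have "len (s \<otimes> x) < len x" using r l by linarith
  then have s: "s \<in> K" using parabolic_descent K st by blast
  then have sx: "s \<otimes> x \<in> generate W K" using K by (blast intro: parabolic_mult generate.incl)
  have "len (s \<otimes> x \<otimes> ?t) < len (s \<otimes> x)"
    using r l len_mult_S[of s x] c st by linarith
  then have "?t \<in> K" using parabolic_descent_right sx K c by blast
  then have "s \<otimes> x \<otimes> ?t \<in> generate W K" using sx K by (blast intro: parabolic_mult generate.incl)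
  then show ?thesis using eq by blast
qed

end

section \<open>Graph automorphisms\<close>

context
  fixes \<sigma> assumes \<sigma>: "graph_automorphism \<sigma>"
begin

lemma graph_hom: "\<sigma> \<in> hom W W"
  using \<sigma> by (auto simp: graph_automorphism_def iso_def)

lemma graph_closed [simp]: "x \<in> carrier W \<Longrightarrow> \<sigma> x \<in> carrier W"
  using graph_hom by (auto simp: hom_def)

lemma graph_mult: "x \<in> carrier W \<Longrightarrow> y \<in> carrier W \<Longrightarrow> \<sigma> (x \<otimes> y) = \<sigma> x \<otimes> \<sigma> y"
  using graph_hom by (auto simp: hom_def)

lemma graph_one [simp]: "\<sigma> \<one> = \<one>"
  using hom_one[OF graph_hom] is_group by blast

lemma graph_S [simp]: "s \<in> S \<Longrightarrow> \<sigma> s \<in> S"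
  using \<sigma> by (auto simp: graph_automorphism_def)

lemma graph_inj: "inj_on \<sigma> (carrier W)"
  using \<sigma> by (auto simp: graph_automorphism_def iso_def bij_betw_def)

lemma graph_image_S: "\<sigma> ` S = S"
  using \<sigma> by (auto simp: graph_automorphism_def)

lemma graph_word: "set u \<subseteq> S \<Longrightarrow> \<sigma> (word_prod W u) = word_prod W (map \<sigma> u)"
  by (induction u) (auto simp: graph_mult)

lemma graph_generate:
  assumes "K \<subseteq> S"
  shows "\<sigma> ` generate W K = generate W (\<sigma> ` K)"
proof -
  interpret group_hom W W \<sigma>
    using graph_hom by unfold_locales
  show ?thesis using generate_img[of K] assms S_subset by auto
qed

lemma graph_len [simp]:
  assumes "x \<in> carrier W"
  shows "len (\<sigma> x) = len x"
proof (rule antisym)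
  obtain u where "set u \<subseteq> S" "length u = len x" "word_prod W u = x"
    using reduced_word assms by blast
  moreover from this have "set (map \<sigma> u) \<subseteq> S" by auto
  ultimately show "len (\<sigma> x) \<le> len x"
    using len_le[of "map \<sigma> u"] graph_word[of u] by simp
  obtain v where v: "set v \<subseteq> S" "length v = len (\<sigma> x)" "word_prod W v = \<sigma> x"
    using reduced_word assms by (metis graph_closed)
  then have "v \<in> lists (\<sigma> ` S)" unfolding graph_image_S by (simp add: in_lists_conv_set subset_iff)
  then obtain v' where v': "v = map \<sigma> v'" "set v' \<subseteq> S"
    unfolding lists_image by (auto simp: in_lists_conv_set)
  then have "\<sigma> (word_prod W v') = \<sigma> x" using graph_word v by simp
  then have "word_prod W v' = x"
    using graph_inj assms v' by (auto dest: inj_onD)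
  then show "len x \<le> len (\<sigma> x)" using len_le[of v'] v v' by simp
qed

end

end

section \<open>Weyl distance\<close>

context building
begin

lemma dist_self [simp]: "C \<in> Ch \<Longrightarrow> \<delta> C C = \<one>"
  using WD1 by blast

lemma adjacent_sym:
  assumes "C \<in> Ch" "D \<in> Ch" "s \<in> S" "\<delta> C D = s"
  shows "\<delta> D C = s"
proof -
  have "\<delta> C C \<in> {s \<otimes> \<delta> D C, \<delta> D C}"
    using WD2[of D C C s] assms by blast
  moreover have "\<delta> D C \<noteq> \<one>" using WD1 assms one_notin_S by metis
  ultimately have "s \<otimes> \<delta> D C = \<one>" using assms by auto
  then have "s \<otimes> (s \<otimes> \<delta> D C) = s" using assms by simp
  then show ?thesis using assms dist_closed by simp
qed

text \<open>A gallery is recorded only by its type and its ends. As 1 is not in \<open>S\<close>, a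
  gallery with type over \<open>S\<close> does not stutter.\<close>

primrec gallery :: "'a list \<Rightarrow> 'c \<Rightarrow> 'c \<Rightarrow> bool" where
  "gallery [] C D \<longleftrightarrow> C = D"
| "gallery (s # u) C D \<longleftrightarrow> (\<exists>E\<in>Ch. \<delta> C E = s \<and> gallery u E D)"

lemma gallery_exists:
  assumes "set u \<subseteq> S" "C \<in> Ch" "D \<in> Ch" "\<delta> C D = word_prod W u"
  shows "gallery u C D"
  using assms
proof (induction u arbitrary: C)
  case (Cons s u)
  then obtain E where E: "E \<in> Ch" "\<delta> E C = s" "\<delta> E D = s \<otimes> \<delta> C D"
    using WD3[of C D s] by auto
  then have "\<delta> C E = s" using adjacent_sym[of E C] Cons.prems by auto
  moreover have "gallery u E D" using Cons E by simp
  ultimately show ?case using E by auto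
qed (use WD1 in simp)

lemma gallery_dist:
  assumes "gallery u C D" "set u \<subseteq> S" "length u = len (word_prod W u)" "C \<in> Ch" "D \<in> Ch"
  shows "\<delta> C D = word_prod W u"
  using assms
proof (induction u arbitrary: C)
  case (Cons s u)
  then obtain E where E: "E \<in> Ch" "\<delta> C E = s" "gallery u E D" by auto
  have l: "length u = len (word_prod W u)" "len (s \<otimes> word_prod W u) = len (word_prod W u) + 1"
    using len_mult_S[of s "word_prod W u"] len_le[of u] Cons.prems by auto
  then have "\<delta> E D = word_prod W u" using Cons E by simp
  then show ?case using WD2_longer[of E D C s] E Cons.prems l by simp
qed simp

lemma gallery_append:
  "C \<in> Ch \<Longrightarrow> gallery (u @ v) C D \<longleftrightarrow> (\<exists>E\<in>Ch. gallery u C E \<and> gallery v E D)"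
  by (induction u arbitrary: C) auto

lemma gallery_rev:
  "gallery u C D \<Longrightarrow> set u \<subseteq> S \<Longrightarrow> C \<in> Ch \<Longrightarrow> D \<in> Ch \<Longrightarrow> gallery (rev u) D C"
proof (induction u arbitrary: C)
  case (Cons s u)
  then obtain E where E: "E \<in> Ch" "\<delta> C E = s" "gallery u E D" by auto
  then have "gallery (rev u) D E" "\<delta> E C = s" using Cons adjacent_sym[of C E s] by auto
  then show ?case using Cons.prems E by (auto simp: gallery_append)
qed simp

lemma dist_reduced_gallery:
  assumes "C \<in> Ch" "D \<in> Ch"
  obtains u where "set u \<subseteq> S" "length u = len (\<delta> C D)" "word_prod W u = \<delta> C D" "gallery u C D"
  using reduced_word[OF dist_closed[OF assms]] gallery_exists assms by metis

lemma dist_sym: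
  assumes "C \<in> Ch" "D \<in> Ch"
  shows "\<delta> D C = inv (\<delta> C D)"
proof -
  obtain u where u: "set u \<subseteq> S" "length u = len (\<delta> C D)" "word_prod W u = \<delta> C D" "gallery u C D"
    using dist_reduced_gallery assms by blast
  then have "\<delta> D C = word_prod W (rev u)"
    using assms dist_closed by (intro gallery_dist gallery_rev) (auto simp: word_prod_rev)
  then show ?thesis using u by (simp add: word_prod_rev)
qed

lemma dist_mult:
  assumes "C \<in> Ch" "D \<in> Ch" "E \<in> Ch"
    and "len (\<delta> C D \<otimes> \<delta> D E) = len (\<delta> C D) + len (\<delta> D E)"
  shows "\<delta> C E = \<delta> C D \<otimes> \<delta> D E"
proof -
  obtain u where u: "set u \<subseteq> S" "length u = len (\<delta> C D)" "word_prod W u = \<delta> C D" "gallery u C D"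
    using dist_reduced_gallery assms by blast
  obtain v where v: "set v \<subseteq> S" "length v = len (\<delta> D E)" "word_prod W v = \<delta> D E" "gallery v D E"
    using dist_reduced_gallery assms by blast
  have "gallery (u @ v) C E" using gallery_append u v assms by blast
  then show ?thesis
    using gallery_dist[of "u @ v"] u v assms by (auto simp: word_prod_append)
qed

lemma WD2_right:
  assumes "C \<in> Ch" "D \<in> Ch" "E \<in> Ch" "s \<in> S" "\<delta> D E = s"
  shows "\<delta> C E = \<delta> C D \<otimes> s \<or> \<delta> C E = \<delta> C D"
proof -
  have "\<delta> E C \<in> {s \<otimes> \<delta> D C, \<delta> D C}"
    using WD2[of D C E s] adjacent_sym assms by blast
  then show ?thesis
    using dist_sym[of E C] dist_sym[of C D] dist_closed[of C D] assms
    by (auto simp: inv_mult_group)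
qed

lemma WD2_right_longer:
  assumes "C \<in> Ch" "D \<in> Ch" "E \<in> Ch" "s \<in> S" "\<delta> D E = s"
    and "len (\<delta> C D) < len (\<delta> C D \<otimes> s)"
  shows "\<delta> C E = \<delta> C D \<otimes> s"
  using dist_mult[of C D E] len_mult_S_right[of s "\<delta> C D"] dist_closed[of C D] assms by simp

lemma WD2_left_longer:
  assumes "C \<in> Ch" "D \<in> Ch" "E \<in> Ch" "s \<in> S" "\<delta> E C = s"
    and "len (\<delta> C D) < len (s \<otimes> \<delta> C D)"
  shows "\<delta> E D = s \<otimes> \<delta> C D"
  using WD2_longer[of C D E s] len_mult_S[of s "\<delta> C D"] dist_closed[of C D] assms by auto

lemma WD3_right:
  assumes "C \<in> Ch" "D \<in> Ch" "s \<in> S"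
  shows "\<exists>E\<in>Ch. \<delta> D E = s \<and> \<delta> C E = \<delta> C D \<otimes> s"
proof -
  obtain E where E: "E \<in> Ch" "\<delta> E D = s" "\<delta> E C = s \<otimes> \<delta> D C"
    using WD3[of D C s] assms by blast
  then have "\<delta> C E = \<delta> C D \<otimes> s"
    using dist_sym[of E C] dist_sym[of C D] dist_closed[of C D] assms by (simp add: inv_mult_group)
  then show ?thesis using E adjacent_sym assms by blast
qed

lemma adjacent_trans:
  assumes "C \<in> Ch" "D \<in> Ch" "E \<in> Ch" "s \<in> S" "\<delta> C D = s" "\<delta> C E = s" "D \<noteq> E"
  shows "\<delta> D E = s"
  using WD2[of C E D s] adjacent_sym[of C D s] WD1[of D E] assms by auto

text \<open>Walk from A to B inside the residue: by \<open>WD2\<close> each step multiplies the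
  distance to D on the left by its letter or leaves it alone.\<close>

lemma dist_coset:
  assumes K: "K \<subseteq> S" and "A \<in> Ch" "B \<in> Ch" "D \<in> Ch" "\<delta> A B \<in> generate W K"
  shows "\<exists>x\<in>generate W K. \<delta> A D = x \<otimes> \<delta> B D"
proof -
  obtain u where u: "set u \<subseteq> K" "word_prod W u = \<delta> A B"
    using generate_words assms by blast
  then have "gallery u A B" using gallery_exists[of u A B] assms by auto
  with u(1) show ?thesis
    using assms(2)
  proof (induction u arbitrary: A)
    case Nil
    then show ?case using dist_closed assms by (intro bexI[of _ \<one>]) (auto intro: generate.one)
  next
    case (Cons s u)
    then obtain E where E: "E \<in> Ch" "\<delta> A E = s" "gallery u E B" by auto
    then obtain x where x: "x \<in> generate W K" "\<delta> E D = x \<otimes> \<delta> B D" using Cons by auto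
    have s: "s \<in> K" "s \<in> S" using Cons.prems K by auto
    have c: "x \<in> carrier W" "\<delta> B D \<in> carrier W"
      using generate_carrier K x dist_closed assms by blast+
    have "s \<otimes> x \<in> generate W K" using parabolic_mult K x s generate.incl[of s K] by blast
    moreover have "\<delta> A D = (s \<otimes> x) \<otimes> \<delta> B D \<or> \<delta> A D = x \<otimes> \<delta> B D"
      using WD2[of E D A s] E Cons.prems s x assms c by (auto simp: m_assoc)
    ultimately show ?case using x by blast
  qed
qed

lemma dist_coset_right:
  assumes K: "K \<subseteq> S" and "A \<in> Ch" "B \<in> Ch" "D \<in> Ch" "\<delta> A B \<in> generate W K"
  shows "\<exists>x\<in>generate W K. \<delta> D B = \<delta> D A \<otimes> x"
proof -
  have "\<delta> B A \<in> generate W K" using dist_sym[of A B] generate_inv assms by metis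
  then obtain x where x: "x \<in> generate W K" "\<delta> B D = x \<otimes> \<delta> A D"
    using dist_coset assms by blast
  have "x \<in> carrier W" "\<delta> A D \<in> carrier W"
    using generate_carrier K x dist_closed assms by blast+
  then have "\<delta> D B = \<delta> D A \<otimes> inv x"
    using x dist_sym[of B D] dist_sym[of A D] assms by (simp add: inv_mult_group)
  then show ?thesis using generate_inv K x by blast
qed

lemma dist_parabolic_trans:
  assumes "K \<subseteq> S" "A \<in> Ch" "B \<in> Ch" "D \<in> Ch" "\<delta> A B \<in> generate W K"
  shows "\<delta> A D \<in> generate W K \<longleftrightarrow> \<delta> B D \<in> generate W K"
proof -
  have "\<delta> A D \<in> generate W K" if "\<delta> A B \<in> generate W K" "\<delta> B D \<in> generate W K" "A \<in> Ch" "B \<in> Ch" for A B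
    using dist_coset[of K A B D] parabolic_mult assms that by metis
  moreover have "\<delta> B A \<in> generate W K" using dist_sym[of A B] generate_inv assms by metis
  ultimately show ?thesis using assms by blast
qed

text \<open>Of the two outcomes allowed by \<open>WD2\<close>, \<open>WD3\<close> always provides
  the multiplied one, so every element of the coset occurs.\<close>

lemma dist_coset_surj:
  assumes K: "K \<subseteq> S" and "C \<in> Ch" "D \<in> Ch" "x \<in> generate W K"
  shows "\<exists>A\<in>Ch. \<delta> C A \<in> generate W K \<and> \<delta> A D = x \<otimes> \<delta> C D"
proof -
  obtain u where u: "set u \<subseteq> K" "word_prod W u = x"
    using generate_words assms by blast
  have "\<exists>A\<in>Ch. \<delta> C A \<in> generate W K \<and> \<delta> A D = word_prod W u \<otimes> \<delta> C D"
    using u(1)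
  proof (induction u)
    case Nil
    then show ?case using assms dist_closed by (intro bexI[of _ C]) (auto intro: generate.one)
  next
    case (Cons s u)
    then obtain A where A: "A \<in> Ch" "\<delta> C A \<in> generate W K" "\<delta> A D = word_prod W u \<otimes> \<delta> C D" by auto
    have s: "s \<in> K" "s \<in> S" "set u \<subseteq> S" using Cons.prems K by auto
    obtain B where B: "B \<in> Ch" "\<delta> B A = s" "\<delta> B D = s \<otimes> \<delta> A D"
      using WD3[of A D s] A s assms by blast
    have "\<delta> A B \<in> generate W K" using adjacent_sym[of B A s] A B s generate.incl[of s K] by simp
    then have "\<delta> C B \<in> generate W K"
      using dist_parabolic_trans[of K A C B] dist_sym[of C A] generate_inv A B assms by metis
    then show ?case using A B s assms dist_closed by (auto simp: m_assoc)
  qed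
  then show ?thesis using u by simp
qed

lemma dist_surj:
  assumes "C \<in> Ch" "w \<in> carrier W"
  shows "\<exists>D\<in>Ch. \<delta> C D = w"
proof -
  obtain A where "A \<in> Ch" "\<delta> A C = inv w \<otimes> \<delta> C C"
    using dist_coset_surj[of S C C "inv w"] assms generates by auto
  then show ?thesis using dist_sym[of A C] assms by auto
qed

section \<open>Residues as simplices, their types, and thick panels\<close>

lemma simplex_rebase:
  assumes "simplex_of_type J \<alpha>" "A \<in> \<alpha>"
  shows "\<alpha> = {B \<in> Ch. \<delta> A B \<in> generate W (S - J)}"
proof -
  obtain A' where A': "A' \<in> Ch" "\<alpha> = {B \<in> Ch. \<delta> A' B \<in> generate W (S - J)}"
    using assms by (auto simp: simplex_of_type_def)
  then show ?thesis
    using assms dist_parabolic_trans[of "S - J" A' A] by auto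
qed

lemma simplex_subset: "simplex_of_type J \<alpha> \<Longrightarrow> \<alpha> \<subseteq> Ch"
  by (auto simp: simplex_of_type_def)

text \<open>A residue of A contains an s-neighbour of A exactly for the s in its generating set.
  This identifies the type J quantified inside \<open>opposite\<close> with a given one.\<close>

lemma simplex_type_unique:
  assumes "simplex_of_type J \<alpha>" "simplex_of_type J' \<alpha>"
  shows "J = J'"
proof -
  have "S - J \<subseteq> S - J'" if J: "simplex_of_type J \<alpha>" and J': "simplex_of_type J' \<alpha>" for J J'
  proof
    fix s assume s: "s \<in> S - J"
    obtain A where A: "A \<in> Ch" "\<alpha> = {B \<in> Ch. \<delta> A B \<in> generate W (S - J)}"
      using J by (auto simp: simplex_of_type_def)
    then have "A \<in> \<alpha>" by (auto intro: generate.one)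
    then have \<alpha>: "\<alpha> = {B \<in> Ch. \<delta> A B \<in> generate W (S - J')}"
      using simplex_rebase J' by blast
    obtain D where D: "D \<in> Ch" "\<delta> A D = s" using dist_surj[of A s] A s by auto
    then have "D \<in> \<alpha>" using A generate.incl[of s "S - J"] s by auto
    then have "s \<in> generate W (S - J')" using \<alpha> D by auto
    then show "s \<in> S - J'" using S_in_parabolic s by blast
  qed
  moreover have "J \<subseteq> S" "J' \<subseteq> S" using assms by (auto simp: simplex_of_type_def)
  ultimately show ?thesis using assms by blast
qed

lemma generate_singleton:
  assumes "s \<in> S" "x \<in> generate W {s}"
  shows "x = \<one> \<or> x = s"
  using assms(2) by induction (use assms(1) in auto)

lemma thick_panel:
  assumes thick "C \<in> Ch" "s \<in> S"
  obtains D E where "D \<in> Ch" "E \<in> Ch" "\<delta> C D = s" "\<delta> C E = s" "D \<noteq> E"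
proof -
  let ?P = "{B \<in> Ch. \<delta> C B \<in> generate W (S - (S - {s}))}" and ?Q = "{B \<in> Ch. \<delta> C B = s}"
  have "simplex_of_type (S - {s}) ?P" using assms by (auto simp: simplex_of_type_def)
  then have big: "infinite ?P \<or> 3 \<le> card ?P" using assms by (auto simp: thick_def)
  have "S - (S - {s}) = {s}" using assms by blast
  then have sub: "?P \<subseteq> insert C ?Q" using generate_singleton[OF assms(3)] WD1 assms(2) by fastforce
  have "\<not> (\<forall>D\<in>?Q. \<forall>E\<in>?Q. D = E)"
  proof
    assume "\<forall>D\<in>?Q. \<forall>E\<in>?Q. D = E"
    then obtain D where "?Q \<subseteq> {D}" by blast
    then have "?P \<subseteq> {C, D}" using sub by blast
    then have "finite ?P" "card ?P \<le> 2"
      using finite_subset[of ?P "{C, D}"] card_mono[of "{C, D}" ?P] by (auto simp: card_insert_if split: if_splits)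
    then show False using big by linarith
  qed
  then show ?thesis using that by blast
qed

end

section \<open>Displacements of constant parity\<close>

text \<open>Uniclassness enters in the form of constant parity of the displacement lengths.\<close>

locale even_displacement = building W S Ch \<delta>
  for W (structure) and S and Ch :: "'c set" and \<delta> +
  fixes \<theta> :: "'c \<Rightarrow> 'c" and \<sigma> :: "'a \<Rightarrow> 'a"
  assumes thick: thick
    and spherical: spherical_type
    and bij: "bij_betw \<theta> Ch Ch"
    and companion: "companion \<theta> \<sigma>"
    and parity: "\<lbrakk>C \<in> Ch; D \<in> Ch\<rbrakk> \<Longrightarrow> even (len (\<delta> C (\<theta> C))) = even (len (\<delta> D (\<theta> D)))"
begin

lemma graph_aut: "graph_automorphism \<sigma>"
  using companion by (simp add: companion_def)

lemmas graph_simps [simp] = graph_closed[OF graph_aut] graph_one[OF graph_aut]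
  graph_S[OF graph_aut] graph_len[OF graph_aut]

lemma image_closed [simp]: "C \<in> Ch \<Longrightarrow> \<theta> C \<in> Ch"
  using bij by (auto simp: bij_betw_def)

text \<open>The companion property concerns adjacent chambers; it extends along reduced galleries
  because \<sigma> preserves length, so image galleries are again reduced.\<close>

lemma dist_image:
  assumes "C \<in> Ch" "D \<in> Ch"
  shows "\<delta> (\<theta> C) (\<theta> D) = \<sigma> (\<delta> C D)"
proof -
  obtain u where u: "set u \<subseteq> S" "length u = len (\<delta> C D)" "word_prod W u = \<delta> C D" "gallery u C D"
    using dist_reduced_gallery assms by blast
  have "gallery (map \<sigma> u) (\<theta> C) (\<theta> D)"
    using u(4,1) assms
  proof (induction u arbitrary: C)
    case (Cons s u)
    then obtain E where "E \<in> Ch" "\<delta> C E = s" "gallery u E D" by auto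
    then show ?case using Cons companion
      by (auto simp: companion_def intro!: bexI[of _ "\<theta> E"])
  qed simp
  moreover have "word_prod W (map \<sigma> u) = \<sigma> (\<delta> C D)"
    using graph_word[OF graph_aut] u by metis
  moreover have "set (map \<sigma> u) \<subseteq> S" using u by auto
  ultimately show ?thesis
    using gallery_dist[of "map \<sigma> u" "\<theta> C" "\<theta> D"] u assms dist_closed by simp
qed

lemma dist_image_adjacent:
  "C \<in> Ch \<Longrightarrow> D \<in> Ch \<Longrightarrow> \<delta> C D = s \<Longrightarrow> \<delta> (\<theta> C) (\<theta> D) = \<sigma> s"
  by (simp add: dist_image)

lemma simplex_image:
  assumes "simplex_of_type J \<alpha>"
  shows "simplex_of_type (\<sigma> ` J) (\<theta> ` \<alpha>)"
proof -
  obtain A where A: "A \<in> Ch" "\<alpha> = {B \<in> Ch. \<delta> A B \<in> generate W (S - J)}" and J: "J \<subseteq> S"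
    using assms by (auto simp: simplex_of_type_def)
  have "S - \<sigma> ` J = \<sigma> ` (S - J)"
    using graph_inj[OF graph_aut] graph_image_S[OF graph_aut] J S_subset
    by (subst inj_on_image_set_diff[of _ "carrier W"]) auto
  then have gen: "generate W (S - \<sigma> ` J) = \<sigma> ` generate W (S - J)"
    using graph_generate[OF graph_aut, of "S - J"] by auto
  have "\<sigma> x \<in> \<sigma> ` generate W (S - J) \<longleftrightarrow> x \<in> generate W (S - J)" if "x \<in> carrier W" for x
    using graph_inj[OF graph_aut] generate_carrier[of "S - J"] that
    by (intro inj_on_image_mem_iff[of _ "carrier W"]) auto
  then have iff: "\<delta> (\<theta> A) (\<theta> B) \<in> generate W (S - \<sigma> ` J) \<longleftrightarrow> \<delta> A B \<in> generate W (S - J)"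
    if "B \<in> Ch" for B
    using that A gen dist_image dist_closed by simp
  have "{B \<in> \<theta> ` Ch. \<delta> (\<theta> A) B \<in> generate W (S - \<sigma> ` J)} = \<theta> ` \<alpha>"
    unfolding A using iff by auto
  moreover have "\<theta> ` Ch = Ch" using bij by (simp add: bij_betw_def)
  ultimately have "\<theta> ` \<alpha> = {B \<in> Ch. \<delta> (\<theta> A) B \<in> generate W (S - \<sigma> ` J)}"
    by simp
  moreover have "\<sigma> ` J \<subseteq> S" using J by auto
  ultimately show ?thesis using A(1) unfolding simplex_of_type_def by (metis image_closed)
qed

section \<open>Displacements of adjacent chambers\<close>

definition displ :: "'c \<Rightarrow> 'a" where
  "displ C = \<delta> C (\<theta> C)"

lemma displ_closed [simp]: "C \<in> Ch \<Longrightarrow> displ C \<in> carrier W"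
  by (simp add: displ_def dist_closed)

lemma displ_parity: "C \<in> Ch \<Longrightarrow> D \<in> Ch \<Longrightarrow> even (len (displ C)) = even (len (displ D))"
  unfolding displ_def by (rule parity)

text \<open>Moving both C and its image multiplies by s on the left or not, and by
  \<open>\<sigma> s\<close> on the right or not. Multiplying on exactly one side would change the
  parity of the length.\<close>

lemma displ_adjacent:
  assumes "C \<in> Ch" "D \<in> Ch" "s \<in> S" "\<delta> C D = s"
  shows "displ D = displ C \<or> displ D = s \<otimes> displ C \<otimes> \<sigma> s"
proof -
  let ?u = "displ C"
  have "\<delta> D (\<theta> C) = s \<otimes> ?u \<or> \<delta> D (\<theta> C) = ?u"
    using WD2[of C "\<theta> C" D s] adjacent_sym[of C D s] assms by (auto simp: displ_def)
  moreover have "displ D = \<delta> D (\<theta> C) \<otimes> \<sigma> s \<or> displ D = \<delta> D (\<theta> C)"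
    using WD2_right[of D "\<theta> C" "\<theta> D" "\<sigma> s"] dist_image_adjacent assms by (simp add: displ_def)
  moreover have "displ D \<noteq> s \<otimes> ?u" "displ D \<noteq> ?u \<otimes> \<sigma> s"
    using displ_parity[of C D] even_len_mult[of s ?u] even_len_mult[of ?u "\<sigma> s"] assms by auto
  ultimately show ?thesis by auto
qed

text \<open>A total gain of two means that each one-sided multiplication lengthens, and then the
  Weyl distance leaves no choice.\<close>

lemma displ_adjacent_up:
  assumes "C \<in> Ch" "D \<in> Ch" "s \<in> S" "\<delta> C D = s"
    and "len (s \<otimes> displ C \<otimes> \<sigma> s) = len (displ C) + 2"
  shows "displ D = s \<otimes> displ C \<otimes> \<sigma> s"
proof -
  let ?u = "displ C"
  have "len (s \<otimes> ?u) = len ?u + 1 \<or> len ?u = len (s \<otimes> ?u) + 1"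
    "len (s \<otimes> ?u \<otimes> \<sigma> s) = len (s \<otimes> ?u) + 1 \<or> len (s \<otimes> ?u) = len (s \<otimes> ?u \<otimes> \<sigma> s) + 1"
    using assms by (intro len_mult_S len_mult_S_right; simp)+
  then have l: "len ?u < len (s \<otimes> ?u)" "len (s \<otimes> ?u) < len (s \<otimes> ?u \<otimes> \<sigma> s)"
    using assms(5) by linarith+
  then have "\<delta> D (\<theta> C) = s \<otimes> ?u"
    using WD2_left_longer[of C "\<theta> C" D s] adjacent_sym[of C D s] assms by (auto simp: displ_def)
  then show ?thesis
    using WD2_right_longer[of D "\<theta> C" "\<theta> D" "\<sigma> s"] dist_image_adjacent l assms
    by (simp add: displ_def)
qed

text \<open>
  Otherwise \<open>\<theta>\<close> would map every chamber \<open>D \<noteq> C\<close> of the \<open>s\<close>-panel of \<open>C\<close> to the projection of \<open>C\<close>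
  onto the image panel; a thick panel contains two such \<open>D\<close>.
\<close>

lemma no_cyclic_shift_up_down:
  assumes "C \<in> Ch" "s \<in> S"
    and len: "len (displ C) < len (s \<otimes> displ C)" "len (displ C \<otimes> \<sigma> s) < len (displ C)"
  shows "s \<otimes> displ C \<otimes> \<sigma> s = displ C"
proof (rule ccontr)
  let ?u = "displ C"
  assume ne: "s \<otimes> ?u \<otimes> \<sigma> s \<noteq> ?u"
  have ne': "?u \<noteq> ?u \<otimes> \<sigma> s" using len by auto
  have c: "?u \<in> carrier W" "s \<in> carrier W" "\<sigma> s \<in> S" using assms by auto
  \<comment> \<open>The distance is computed in two ways, from the displacement of D by changing the
    first chamber and from that of C by changing the second. By \<open>ne\<close> the two pairs of
    candidates share only this value.\<close>
  have D: "\<delta> C (\<theta> D) = ?u \<otimes> \<sigma> s" if D: "D \<in> Ch" "\<delta> C D = s" for D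
  proof -
    have "\<delta> D (\<theta> C) = s \<otimes> ?u"
      using WD2_left_longer[of C "\<theta> C" D s] adjacent_sym[of C D s] assms D by (simp add: displ_def)
    then have "displ D = s \<otimes> ?u \<otimes> \<sigma> s \<or> displ D = s \<otimes> ?u"
      using WD2_right[of D "\<theta> C" "\<theta> D" "\<sigma> s"] dist_image_adjacent assms D by (simp add: displ_def)
    moreover have "displ D \<noteq> s \<otimes> ?u"
      using displ_parity[of C D] even_len_mult[of s ?u] assms D by auto
    ultimately have dD: "displ D = s \<otimes> ?u \<otimes> \<sigma> s" by blast
    have "\<delta> C (\<theta> D) = s \<otimes> displ D \<or> \<delta> C (\<theta> D) = displ D"
      using WD2[of D "\<theta> D" C s] assms D by (auto simp: displ_def)
    then have "\<delta> C (\<theta> D) = ?u \<otimes> \<sigma> s \<or> \<delta> C (\<theta> D) = s \<otimes> ?u \<otimes> \<sigma> s"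
      unfolding dD using c assms by (simp add: m_assoc)
    moreover have "\<delta> C (\<theta> D) = ?u \<otimes> \<sigma> s \<or> \<delta> C (\<theta> D) = ?u"
      using WD2_right[of C "\<theta> C" "\<theta> D" "\<sigma> s"] dist_image_adjacent assms D by (simp add: displ_def)
    ultimately show ?thesis using ne by auto
  qed
  \<comment> \<open>Images of two such chambers are adjacent. Since \<open>\<sigma> s\<close>
    lengthens their common distance from C, they cannot have the same distance.\<close>
  obtain D E where DE: "D \<in> Ch" "E \<in> Ch" "\<delta> C D = s" "\<delta> C E = s" "D \<noteq> E"
    using thick_panel thick assms by blast
  have "\<delta> (\<theta> D) (\<theta> E) = \<sigma> s"
    using adjacent_trans[of C D E s] dist_image_adjacent DE assms by blast
  then have "\<delta> C (\<theta> E) = \<delta> C (\<theta> D) \<otimes> \<sigma> s"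
    using WD2_right_longer[of C "\<theta> D" "\<theta> E" "\<sigma> s"] D[of D] DE assms c by simp
  then have "\<delta> C (\<theta> E) = ?u" using D[of D] DE c by simp
  then show False using D[of E] DE ne' by simp
qed

text \<open>Four cases, by whether s on the left and \<open>\<sigma> s\<close> on the right
  lengthen. If both or neither do, the exchange property suffices. If only the left one does, the
  previous lemma applies. If only the right one does, a neighbour D with displacement s u
  \<sigma>(s) has the roles of the sides reversed.\<close>

lemma no_cyclic_shift:
  assumes "C \<in> Ch" "s \<in> S" and eq: "len (s \<otimes> displ C \<otimes> \<sigma> s) = len (displ C)"
  shows "s \<otimes> displ C \<otimes> \<sigma> s = displ C"
proof -
  let ?u = "displ C"
  have c: "?u \<in> carrier W" "s \<in> carrier W" "\<sigma> s \<in> S" using assms by auto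
  have l: "len (s \<otimes> ?u) = len ?u + 1 \<or> len ?u = len (s \<otimes> ?u) + 1"
    using len_mult_S assms by simp
  have r: "len (?u \<otimes> \<sigma> s) = len ?u + 1 \<or> len ?u = len (?u \<otimes> \<sigma> s) + 1"
    using len_mult_S_right c by blast
  consider "len ?u < len (s \<otimes> ?u)" "len ?u < len (?u \<otimes> \<sigma> s)"
    | "len ?u < len (s \<otimes> ?u)" "len (?u \<otimes> \<sigma> s) < len ?u"
    | "len (s \<otimes> ?u) < len ?u" "len ?u < len (?u \<otimes> \<sigma> s)"
    | "len (s \<otimes> ?u) < len ?u" "len (?u \<otimes> \<sigma> s) < len ?u"
    using l r by linarith
  then show ?thesis
  proof cases
    case 1
    then have "s \<otimes> ?u = ?u \<otimes> \<sigma> s"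
      using commute_of_len[of s "\<sigma> s" ?u] assms c by (simp add: m_assoc)
    then show ?thesis using c by simp
  next
    case 2
    then show ?thesis using no_cyclic_shift_up_down assms by blast
  next
    case 3
    show ?thesis
    proof (rule ccontr)
      assume ne: "s \<otimes> ?u \<otimes> \<sigma> s \<noteq> ?u"
      obtain D where D: "D \<in> Ch" "\<delta> D C = s" "\<delta> D (\<theta> C) = s \<otimes> ?u"
        using WD3[of C "\<theta> C" s] assms by (auto simp: displ_def)
      then have CD: "\<delta> C D = s" using adjacent_sym[of D C s] assms by simp
      have "displ D = s \<otimes> ?u \<otimes> \<sigma> s \<or> displ D = s \<otimes> ?u"
        using WD2_right[of D "\<theta> C" "\<theta> D" "\<sigma> s"] dist_image_adjacent CD D assms
        by (simp add: displ_def)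
      moreover have "displ D \<noteq> s \<otimes> ?u"
        using displ_parity[of C D] even_len_mult[of s ?u] assms D by auto
      ultimately have dD: "displ D = s \<otimes> ?u \<otimes> \<sigma> s" by blast
      then have sides: "s \<otimes> displ D = ?u \<otimes> \<sigma> s" "displ D \<otimes> \<sigma> s = s \<otimes> ?u"
        using c assms by (simp_all add: m_assoc)
      have "len (displ D) = len ?u" unfolding dD by (rule eq)
      then have "len (displ D) < len (s \<otimes> displ D)" "len (displ D \<otimes> \<sigma> s) < len (displ D)"
        using 3 unfolding sides by linarith+
      then have "s \<otimes> displ D \<otimes> \<sigma> s = displ D"
        using no_cyclic_shift_up_down D assms by blast
      then have "?u = displ D" using dD c assms by (simp add: m_assoc)
      then show False using ne dD by simp
    qed
  next
    case 4
    have "len (s \<otimes> ?u) < len (s \<otimes> ?u \<otimes> \<sigma> s)" using 4 eq by simp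
    then have "s \<otimes> (s \<otimes> ?u) = (s \<otimes> ?u) \<otimes> \<sigma> s"
      using 4 l r commute_of_len[of s "\<sigma> s" "s \<otimes> ?u"] assms c by (simp add: m_assoc)
    then show ?thesis using c assms by simp
  qed
qed

section \<open>Confluence of the displacement graph\<close>

text \<open>Formulated on W rather than on chambers, so that different chambers can share a normal
  form; \<open>up_displ\<close> leads back to chambers.\<close>

definition up :: "'a \<Rightarrow> 'a \<Rightarrow> bool" where
  "up u v \<longleftrightarrow> (\<exists>s\<in>S. v = s \<otimes> u \<otimes> \<sigma> s \<and> len v = len u + 2)"

definition normal_form :: "'a \<Rightarrow> 'a \<Rightarrow> bool" where
  "normal_form u z \<longleftrightarrow> up\<^sup>*\<^sup>* u z \<and> (\<nexists>v. up z v)"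

lemma up_closed: "up u v \<Longrightarrow> u \<in> carrier W \<Longrightarrow> v \<in> carrier W"
  by (auto simp: up_def)

lemma up_normal_form: "up u v \<Longrightarrow> normal_form v z \<Longrightarrow> normal_form u z"
  by (auto simp: normal_form_def intro: converse_rtranclp_into_rtranclp)

text \<open>Lengths grow along \<open>up\<close> and are bounded by that of
  \<open>longest\<close>.\<close>

lemma normal_form_exists:
  assumes "u \<in> carrier W"
  shows "\<exists>z. normal_form u z"
  using assms
proof (induction "len longest - len u" arbitrary: u rule: less_induct)
  case less
  show ?case
  proof (cases "\<exists>v. up u v")
    case True
    then obtain v where v: "up u v" by blast
    then have "v \<in> carrier W" "len u < len v" using up_closed less.prems by (auto simp: up_def)
    moreover have "len v \<le> len longest" using longest_props(2)[OF spherical] calculation by blast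
    ultimately obtain z where "normal_form v z" using less.hyps[of v] by fastforce
    then show ?thesis using up_normal_form[OF v] by blast
  next
    case False
    then show ?thesis by (auto simp: normal_form_def)
  qed
qed

lemma up_displ:
  assumes "C \<in> Ch" "up (displ C) v"
  shows "\<exists>D\<in>Ch. displ D = v"
proof -
  obtain s where s: "s \<in> S" "v = s \<otimes> displ C \<otimes> \<sigma> s" "len v = len (displ C) + 2"
    using assms by (auto simp: up_def)
  obtain D where "D \<in> Ch" "\<delta> C D = s" using dist_surj[of C s] assms s by auto
  then show ?thesis using displ_adjacent_up s assms by blast
qed

lemma up_rtrancl_displ:
  assumes "up\<^sup>*\<^sup>* (displ C) v" "C \<in> Ch"
  shows "\<exists>D\<in>Ch. displ D = v"
  using assms by (induction rule: rtranclp_induct) (use up_displ in blast)+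

lemma displ_adjacent_cases:
  assumes "C \<in> Ch" "D \<in> Ch" "s \<in> S" "\<delta> C D = s"
  obtains "displ D = displ C" | "up (displ C) (displ D)" | "up (displ D) (displ C)"
proof -
  let ?u = "displ C" and ?v = "s \<otimes> displ C \<otimes> \<sigma> s"
  have c: "?u \<in> carrier W" "s \<in> carrier W" "\<sigma> s \<in> S" using assms by auto
  have "len (s \<otimes> ?u) = len ?u + 1 \<or> len ?u = len (s \<otimes> ?u) + 1"
    "len ?v = len (s \<otimes> ?u) + 1 \<or> len (s \<otimes> ?u) = len ?v + 1"
    using c assms by (intro len_mult_S len_mult_S_right; simp)+
  then consider "len ?v = len ?u" | "len ?v = len ?u + 2" | "len ?u = len ?v + 2" by linarith
  then show ?thesis
  proof cases
    case 1
    then show ?thesis using displ_adjacent no_cyclic_shift assms that(1) by metis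
  next
    case 2
    then show ?thesis using displ_adjacent_up[of C D s] assms that(2) by (auto simp: up_def)
  next
    case 3
    have "?u = s \<otimes> ?v \<otimes> \<sigma> s" using c assms by (simp add: m_assoc)
    then have "up ?v ?u" using 3 assms(3) unfolding up_def by blast
    then show ?thesis
      using displ_adjacent[of C D s] assms that(1,3) by metis
  qed
qed

text \<open>Uniqueness is assumed only at C, so that the lemma can serve inside the induction
  proving uniqueness. It matters when the step from C to D goes up: any normal form at D is then one
  at C.\<close>

lemma normal_form_adjacent:
  assumes "C \<in> Ch" "D \<in> Ch" "s \<in> S" "\<delta> C D = s"
    and z: "normal_form (displ C) z"
    and unique: "\<And>z'. normal_form (displ C) z' \<Longrightarrow> z' = z"
  shows "normal_form (displ D) z"
  using assms(1-4)
proof (cases rule: displ_adjacent_cases)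
  case 1
  then show ?thesis using z by simp
next
  case 2
  then obtain z' where "normal_form (displ D) z'" using normal_form_exists assms by fastforce
  then show ?thesis using unique[of z'] up_normal_form[OF 2] by simp
next
  case 3
  then show ?thesis using z up_normal_form by blast
qed

text \<open>E arises from A by an ascent, and an ascent from A is forced for all other chambers of
  the panel. So at most one chamber of a panel lies below E; thickness then allows it to be
  avoided.\<close>

lemma panel_len:
  assumes E: "E \<in> Ch" "r \<in> S" and A: "A \<in> Ch" "\<delta> E A = r" and B: "B \<in> Ch" "\<delta> E B = r" and "A \<noteq> B"
    and less: "len (displ A) < len (displ E)"
  shows "len (displ A) < len (displ B)"
proof -
  have AE: "\<delta> A E = r" and AB: "\<delta> A B = r"
    using adjacent_sym[of E A r] adjacent_trans[of E A B r] assms by auto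
  have dE: "displ E = r \<otimes> displ A \<otimes> \<sigma> r"
    using displ_adjacent[of A E r] AE less E A by auto
  have "len (displ E) = len (displ A) + 2"
    using A(1) E(1) E(2) AE
  proof (cases rule: displ_adjacent_cases)
    case 3
    then show ?thesis using less by (auto simp: up_def)
  qed (use less in \<open>auto simp: up_def\<close>)
  then show ?thesis
    using displ_adjacent_up[of A B r] AB E A B unfolding dE by simp
qed

section \<open>Residues of rank two with two ascents\<close>

context
  fixes C s t
  assumes C: "C \<in> Ch" and st: "s \<in> S" "t \<in> S" "s \<noteq> t"
    and up_s: "len (s \<otimes> displ C \<otimes> \<sigma> s) = len (displ C) + 2"
    and up_t: "len (t \<otimes> displ C \<otimes> \<sigma> t) = len (displ C) + 2"
begin

text \<open>These inequalities make \<open>displ C\<close> the shortest element of its double coset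
  for the parabolic subgroups of {s, t} and its image under \<sigma>.\<close>

lemma ascents:
  assumes "k \<in> {s, t}"
  shows "len (displ C) < len (k \<otimes> displ C)" "len (displ C) < len (displ C \<otimes> \<sigma> k)"
proof -
  let ?u = "displ C"
  have k: "k \<in> S" "len (k \<otimes> ?u \<otimes> \<sigma> k) = len ?u + 2" using assms st up_s up_t by auto
  have c: "?u \<in> carrier W" "\<sigma> k \<in> S" using C k by auto
  have "len (k \<otimes> ?u) = len ?u + 1 \<or> len ?u = len (k \<otimes> ?u) + 1"
    "len (k \<otimes> ?u \<otimes> \<sigma> k) = len (k \<otimes> ?u) + 1 \<or> len (k \<otimes> ?u) = len (k \<otimes> ?u \<otimes> \<sigma> k) + 1"
    using c k by (intro len_mult_S len_mult_S_right; simp)+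
  then show "len ?u < len (k \<otimes> ?u)" using k by linarith
  have "len (?u \<otimes> \<sigma> k) = len ?u + 1 \<or> len ?u = len (?u \<otimes> \<sigma> k) + 1"
    "len (k \<otimes> (?u \<otimes> \<sigma> k)) = len (?u \<otimes> \<sigma> k) + 1 \<or> len (?u \<otimes> \<sigma> k) = len (k \<otimes> (?u \<otimes> \<sigma> k)) + 1"
    using c k by (intro len_mult_S len_mult_S_right; simp)+
  moreover have "len (k \<otimes> (?u \<otimes> \<sigma> k)) = len ?u + 2" using c k by (simp add: m_assoc)
  ultimately show "len ?u < len (?u \<otimes> \<sigma> k)" using k by linarith
qed

lemma K_subset: "{s, t} \<subseteq> S"
  using st by simp

lemma L_subset: "\<sigma> ` {s, t} \<subseteq> S"
  using st by simp

lemma image_parabolic: "x \<in> generate W {s, t} \<Longrightarrow> \<sigma> x \<in> generate W (\<sigma> ` {s, t})"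
  using graph_generate[OF graph_aut K_subset] by blast

lemma displ_residue:
  assumes "E \<in> Ch" "\<delta> C E \<in> generate W {s, t}"
  shows "len (displ C) \<le> len (displ E)" "len (displ E) = len (displ C) \<Longrightarrow> displ E = displ C"
proof -
  have "\<delta> E C \<in> generate W {s, t}"
    using dist_sym[of C E] generate_inv[OF K_subset] C assms by simp
  then obtain a where a: "a \<in> generate W {s, t}" "\<delta> E (\<theta> C) = a \<otimes> displ C"
    using dist_coset[OF K_subset, of E C "\<theta> C"] C assms by (auto simp: displ_def)
  have "\<delta> (\<theta> C) (\<theta> E) \<in> generate W (\<sigma> ` {s, t})"
    using dist_image image_parabolic C assms by simp
  then obtain b where b: "b \<in> generate W (\<sigma> ` {s, t})" "displ E = a \<otimes> displ C \<otimes> b"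
    using dist_coset_right[OF L_subset, of "\<theta> C" "\<theta> E" E] C assms a by (auto simp: displ_def)
  show "len (displ C) \<le> len (displ E)" "len (displ E) = len (displ C) \<Longrightarrow> displ E = displ C"
    unfolding b(2)
    by (rule minimal_in_double_coset[OF K_subset L_subset _ _ _ a(1) b(1)]; use C ascents in auto)+
qed

text \<open>If E had the displacement u of C, the distance from C to the image of E would be both x
  u, through E, and u \<sigma>(x), through the image of C. As s is a descent of x, exchange gives s
  u = u g, where g has length 1 and is thus \<sigma>(s) or \<sigma>(t). The first contradicts the
  ascent at s; the second would make t a descent of x.\<close>

lemma displ_residue_less:
  assumes E: "E \<in> Ch" and x: "\<delta> C E = x" "x \<in> generate W {s, t}"
    and desc: "len (s \<otimes> x) < len x" "len x < len (t \<otimes> x)"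
  shows "len (displ C) < len (displ E)"
proof (rule ccontr)
  let ?u = "displ C"
  assume "\<not> len ?u < len (displ E)"
  moreover have res: "\<delta> C E \<in> generate W {s, t}" using x by simp
  ultimately have "len (displ E) = len ?u" using displ_residue(1)[OF E res] by linarith
  then have dE: "displ E = ?u" using displ_residue(2)[OF E res] by blast
  have c: "x \<in> carrier W" "\<sigma> x \<in> carrier W" "?u \<in> carrier W"
    using generate_carrier[OF K_subset x(2)] C by auto
  have \<sigma>x: "\<sigma> x \<in> generate W (\<sigma> ` {s, t})" using image_parabolic x by blast
  have left: "len (y \<otimes> ?u) = len y + len ?u" if "y \<in> generate W {s, t}" for y
    using parabolic_len_add[OF K_subset c(3) _ that] ascents by blast
  have right: "len (?u \<otimes> y) = len ?u + len y" if "y \<in> generate W (\<sigma> ` {s, t})" for y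
    using parabolic_len_add_right[OF L_subset c(3) _ that] ascents by blast
  have "\<delta> C (\<theta> E) = x \<otimes> ?u"
    using dist_mult[of C E "\<theta> E"] left[OF x(2)] dE C E x by (simp add: displ_def)
  moreover have "\<delta> C (\<theta> E) = ?u \<otimes> \<sigma> x"
    using dist_mult[of C "\<theta> C" "\<theta> E"] dist_image[of C E] right[OF \<sigma>x] C E x by (simp add: displ_def)
  ultimately have eq: "x \<otimes> ?u = ?u \<otimes> \<sigma> x" by simp
  have s: "s \<in> generate W {s, t}" by (rule generate.incl) simp
  have "len (s \<otimes> (?u \<otimes> \<sigma> x)) = len ((s \<otimes> x) \<otimes> ?u)"
    using eq c st by (simp add: m_assoc)
  also have "\<dots> = len (s \<otimes> x) + len ?u" using left parabolic_mult[OF K_subset s x(2)] by blast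
  also have "\<dots> < len (?u \<otimes> \<sigma> x)" using right[OF \<sigma>x] desc c by simp
  finally obtain y where y: "y \<in> generate W (\<sigma> ` {s, t})" "len y < len (\<sigma> x)" "s \<otimes> (?u \<otimes> \<sigma> x) = ?u \<otimes> y"
    using exchange_mult[of s ?u "\<sigma> ` {s, t}" "\<sigma> x"] \<sigma>x L_subset st c ascents(1)[of s] by blast
  let ?g = "y \<otimes> inv (\<sigma> x)"
  have g: "?g \<in> generate W (\<sigma> ` {s, t})"
    using parabolic_mult[OF L_subset y(1)] generate_inv[OF L_subset \<sigma>x] by blast
  have cg: "y \<in> carrier W" "?g \<in> carrier W" using generate_carrier[OF L_subset] y g by blast+
  have "s \<otimes> ?u = s \<otimes> (?u \<otimes> \<sigma> x) \<otimes> inv (\<sigma> x)" using c st by (simp add: m_assoc)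
  then have sg: "s \<otimes> ?u = ?u \<otimes> ?g" unfolding y(3) using c cg by (simp add: m_assoc)
  then have "len (s \<otimes> ?u) = len ?u + len ?g" using right[OF g] by simp
  moreover have "len (s \<otimes> ?u) = len ?u + 1"
    using len_mult_S[of s ?u] ascents(1)[of s] st c by auto
  ultimately have "?g \<in> S" using cg by (intro len_1_in_S) auto
  then have "?g \<in> \<sigma> ` {s, t}" using S_in_parabolic[OF L_subset] g by blast
  then consider "?g = \<sigma> s" | "?g = \<sigma> t" by blast
  then show False
  proof cases
    case 1
    then have "s \<otimes> ?u \<otimes> \<sigma> s = ?u" using sg c st by simp
    then show False using up_s by simp
  next
    case 2
    have "y = ?g \<otimes> \<sigma> x" using cg c by (simp add: m_assoc)
    then have "y = \<sigma> (t \<otimes> x)" unfolding 2 using graph_mult[OF graph_aut] c st by simp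
    then show False using y(2) desc c st by simp
  qed
qed

text \<open>Follow a reduced gallery of type starting with s from C to E. All its chambers after C
  have displacements longer than that of C, where uniqueness is available, so the normal form z
  found after the first step is carried along.\<close>

lemma normal_form_residue:
  assumes z: "normal_form (s \<otimes> displ C \<otimes> \<sigma> s) z"
    and unique: "\<And>D z1 z2. \<lbrakk>D \<in> Ch; len (displ C) < len (displ D);
      normal_form (displ D) z1; normal_form (displ D) z2\<rbrakk> \<Longrightarrow> z1 = z2"
    and "E \<in> Ch" "\<delta> C E = x" "x \<in> generate W {s, t}"
    and "len (s \<otimes> x) < len x" "len x < len (t \<otimes> x)"
  shows "normal_form (displ E) z"
  using assms(3-)
proof (induction "len x" arbitrary: x E rule: less_induct)
  case less
  have "x \<noteq> \<one>" using less.prems st by auto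
  then obtain y r where r: "r \<in> {s, t}" "y \<in> generate W {s, t}" "x = y \<otimes> r" "len x = len y + 1"
    using parabolic_last[OF K_subset less.prems(3)] by metis
  have c: "r \<in> S" "y \<in> carrier W" using r(1,2) K_subset generate_carrier by blast+
  show ?case
  proof (cases "y = \<one>")
    case True
    then have "x = r" using r c by simp
    moreover have "r \<noteq> t" using less.prems calculation st by auto
    ultimately have "x = s" using r by auto
    then have "displ E = s \<otimes> displ C \<otimes> \<sigma> s"
      using displ_adjacent_up[of C E s] less.prems C st up_s by simp
    then show ?thesis using z by simp
  next
    case False
    \<comment> \<open>A left descent t of the prefix y would also be one of x. Since y is not 1, its
      descent in {s, t} is therefore s.\<close>
    have t: "len y < len (t \<otimes> y)"
    proof (rule ccontr)
      assume "\<not> len y < len (t \<otimes> y)"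
      then have "len y = len (t \<otimes> y) + 1" using len_mult_S[of t y] c st by fastforce
      moreover have "t \<otimes> x = (t \<otimes> y) \<otimes> r" unfolding r(3) using c st by (simp add: m_assoc)
      then have "len (t \<otimes> x) \<le> len (t \<otimes> y) + 1"
        using len_mult_S_right[of r "t \<otimes> y"] c st by auto
      ultimately show False using less.prems r(4) by linarith
    qed
    obtain k where "k \<in> {s, t}" "len (k \<otimes> y) < len y"
      using parabolic_first_descent[OF K_subset r(2) False] by blast
    then have s: "len (s \<otimes> y) < len y" using t by auto
    obtain E' where E': "E' \<in> Ch" "\<delta> E E' = r" "\<delta> C E' = y"
      using WD3_right[of C E r] less.prems C c r(3) by auto
    have "normal_form (displ E') z" using less.hyps[of y E'] r E' s t by simp
    moreover have "len (displ C) < len (displ E')"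
      using displ_residue_less E' r s t by blast
    ultimately show ?thesis
      using normal_form_adjacent[of E' E r z] adjacent_sym[of E E' r] unique[of E'] E' less.prems c
      by blast
  qed
qed

end

text \<open>Let q be the longest element of the dihedral group, with predecessors x and y starting
  with s and t. The chambers E and F at distances x and y from C inherit \<open>zs\<close> and
  \<open>zt\<close>, and both are adjacent to a chamber A at distance q.\<close>

lemma local_confluence:
  assumes C: "C \<in> Ch" and st: "s \<in> S" "t \<in> S" "s \<noteq> t"
    and up_s: "len (s \<otimes> displ C \<otimes> \<sigma> s) = len (displ C) + 2"
    and up_t: "len (t \<otimes> displ C \<otimes> \<sigma> t) = len (displ C) + 2"
    and zs: "normal_form (s \<otimes> displ C \<otimes> \<sigma> s) zs" and zt: "normal_form (t \<otimes> displ C \<otimes> \<sigma> t) zt"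
    and unique: "\<And>D z1 z2. \<lbrakk>D \<in> Ch; len (displ C) < len (displ D);
      normal_form (displ D) z1; normal_form (displ D) z2\<rbrakk> \<Longrightarrow> z1 = z2"
  shows "zs = zt"
proof -
  have K: "{s, t} \<subseteq> S" using st by simp
  have ts: "{t, s} = {s, t}" by blast
  let ?P = "\<lambda>x. x \<in> generate W {s, t} \<and> len (s \<otimes> x) < len x \<and> len (t \<otimes> x) < len x"
  \<comment> \<open>A longest element of the finite dihedral group has both descents; q is then
    chosen as a shortest element with this property, as \<open>dihedral_predecessor\<close>
    requires.\<close>
  have "\<exists>x. ?P x"
  proof -
    let ?G = "generate W {s, t}"
    have "?G \<subseteq> carrier W" using generate_carrier[OF K] by blast
    then have fin: "finite (len ` ?G)" using spherical by (auto simp: spherical_type_def intro: finite_subset)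
    have "len ` ?G \<noteq> {}" using generate.one by blast
    then have "Max (len ` ?G) \<in> len ` ?G" using fin by (intro Max_in)
    then obtain x where x: "x \<in> ?G" "len x = Max (len ` ?G)" by auto
    have "len (k \<otimes> x) < len x" if "k \<in> {s, t}" for k
    proof -
      have "k \<otimes> x \<in> ?G" using parabolic_mult[OF K generate.incl[OF that] x(1)] .
      then have "len (k \<otimes> x) \<le> len x" using fin x by simp
      then show ?thesis using len_mult_S[of k x] generate_carrier[OF K x(1)] K that by fastforce
    qed
    then show ?thesis using x by blast
  qed
  then obtain q where q: "?P q" and min: "\<And>x. ?P x \<Longrightarrow> len q \<le> len x"
    using ex_has_least_nat[of ?P _ len] by metis
  obtain x r where x: "r \<in> {s, t}" "x \<in> generate W {s, t}" "q = x \<otimes> r" "len q = len x + 1"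
    "len (s \<otimes> x) < len x" "len x < len (t \<otimes> x)"
    using dihedral_predecessor[of s t q] st q min by metis
  obtain y p where y: "p \<in> {s, t}" "y \<in> generate W {s, t}" "q = y \<otimes> p" "len q = len y + 1"
    "len (t \<otimes> y) < len y" "len y < len (s \<otimes> y)"
    using dihedral_predecessor[of t s q] st q min unfolding ts by metis
  have c: "r \<in> S" "p \<in> S" "x \<in> carrier W" "y \<in> carrier W"
    using x(1) y(1) K generate_carrier[OF K] x(2) y(2) by blast+
  obtain E where E: "E \<in> Ch" "\<delta> C E = x" using dist_surj C c by blast
  have lE: "len (displ C) < len (displ E)"
    using displ_residue_less[OF C st up_s up_t E x(2,5,6)] .
  have nE: "normal_form (displ E) zs"
    by (rule normal_form_residue[OF C st up_s up_t zs _ E x(2,5,6)]) (rule unique)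
  have A: "\<delta> C A = q" "len (displ C) \<le> len (displ A)" if "A \<in> Ch" "\<delta> E A = r" for A
  proof -
    show "\<delta> C A = q" using WD2_right_longer[of C E A r] C E c x that by simp
    then show "len (displ C) \<le> len (displ A)"
      using displ_residue(1)[OF C st up_s up_t] that q by simp
  qed
  \<comment> \<open>Strict length at A is not automatic, unlike at E and F. If a first candidate has
    displacement as short as that of C, a second one in the same panel is strictly longer by
    \<open>panel_len\<close>.\<close>
  obtain A where A': "A \<in> Ch" "\<delta> E A = r" "len (displ C) < len (displ A)"
  proof -
    obtain A B where AB: "A \<in> Ch" "B \<in> Ch" "\<delta> E A = r" "\<delta> E B = r" "A \<noteq> B"
      using thick_panel thick E c by metis
    show ?thesis
    proof (cases "len (displ A) = len (displ C)")
      case True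
      then have "len (displ C) < len (displ B)"
        using panel_len[of E r A B] E c AB lE by simp
      then show ?thesis using that AB by blast
    next
      case False
      then show ?thesis using that AB A(2)[of A] by simp
    qed
  qed
  have "normal_form (displ A) zs"
    using normal_form_adjacent[of E A r zs] nE unique[of E] lE E A' c by blast
  \<comment> \<open>F is built backwards from A, so that the gallery starting with t ends at the
    chosen A.\<close>
  moreover obtain F where F: "F \<in> Ch" "\<delta> A F = p" "\<delta> C F = y"
    using WD3_right[of C A p] A(1)[of A] A' C c y(3) by auto
  have "normal_form (displ F) zt"
    by (rule normal_form_residue[OF C st(2,1) st(3)[symmetric] up_t up_s zt _ F(1,3), unfolded ts,
      OF _ y(2,5,6)]) (rule unique)
  moreover have "len (displ C) < len (displ F)"
    using displ_residue_less[OF C st(2,1) st(3)[symmetric] up_t up_s F(1,3), unfolded ts, OF y(2,5,6)] .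
  ultimately have "normal_form (displ A) zs" "normal_form (displ A) zt"
    using normal_form_adjacent[of F A p zt] adjacent_sym[of A F p] unique[of F] F A' c by blast+
  then show ?thesis using unique A' by blast
qed

text \<open>Newman's induction, downwards from the maximal length: the induction hypothesis is the
  uniqueness at longer displacements that \<open>local_confluence\<close> assumes. If both first
  steps use the same generator, it applies directly to a neighbour.\<close>

lemma normal_form_unique:
  assumes "C \<in> Ch" "normal_form (displ C) z1" "normal_form (displ C) z2"
  shows "z1 = z2"
  using assms
proof (induction "len longest - len (displ C)" arbitrary: C z1 z2 rule: less_induct)
  case less
  have unique: "z1 = z2" if "D \<in> Ch" "len (displ C) < len (displ D)"
    "normal_form (displ D) z1" "normal_form (displ D) z2" for D z1 z2
  proof -
    have "len (displ D) \<le> len longest" using longest_props(2)[OF spherical] that by simp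
    then show ?thesis using less.hyps[of D z1 z2] that by linarith
  qed
  show ?case
  proof (cases "\<exists>v. up (displ C) v")
    case False
    then have "z = displ C" if "normal_form (displ C) z" for z
      using that by (auto simp: normal_form_def elim: converse_rtranclpE)
    then show ?thesis using less.prems by blast
  next
    case True
    have "\<exists>s\<in>S. len (s \<otimes> displ C \<otimes> \<sigma> s) = len (displ C) + 2 \<and> normal_form (s \<otimes> displ C \<otimes> \<sigma> s) z"
      if z: "normal_form (displ C) z" for z
    proof -
      have "displ C \<noteq> z" using z True by (auto simp: normal_form_def)
      then obtain v where "up (displ C) v" "up\<^sup>*\<^sup>* v z"
        using z by (auto simp: normal_form_def elim: converse_rtranclpE)
      then show ?thesis using z by (auto simp: normal_form_def up_def)
    qed
    then obtain s t where s: "s \<in> S" "len (s \<otimes> displ C \<otimes> \<sigma> s) = len (displ C) + 2"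
      "normal_form (s \<otimes> displ C \<otimes> \<sigma> s) z1"
      and t: "t \<in> S" "len (t \<otimes> displ C \<otimes> \<sigma> t) = len (displ C) + 2"
      "normal_form (t \<otimes> displ C \<otimes> \<sigma> t) z2"
      using less.prems by metis
    show ?thesis
    proof (cases "s = t")
      case True
      obtain D where "D \<in> Ch" "displ D = s \<otimes> displ C \<otimes> \<sigma> s"
        using up_displ[of C "s \<otimes> displ C \<otimes> \<sigma> s"] less.prems s by (auto simp: up_def)
      then show ?thesis using unique[of D z1 z2] s t True by simp
    next
      case False
      then show ?thesis
        using local_confluence[OF less.prems(1) s(1) t(1) False s(2) t(2) s(3) t(3)] unique by blast
    qed
  qed
qed

lemma normal_form_constant:
  assumes "C \<in> Ch" "D \<in> Ch" "normal_form (displ C) z"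
  shows "normal_form (displ D) z"
proof -
  obtain u where "set u \<subseteq> S" "gallery u C D"
    using dist_reduced_gallery[OF assms(1,2)] .
  then show ?thesis
    using assms
  proof (induction u arbitrary: C)
    case (Cons s u)
    then obtain E where E: "E \<in> Ch" "\<delta> C E = s" "gallery u E D" by auto
    have C: "C \<in> Ch" "normal_form (displ C) z" and s: "s \<in> S" "set u \<subseteq> S"
      using Cons.prems by auto
    have "normal_form (displ E) z"
      using normal_form_adjacent[OF C(1) E(1) s(1) E(2) C(2)] normal_form_unique[OF C(1) _ C(2)]
      by blast
    then show ?case using Cons.IH s E Cons.prems by blast
  qed simp
qed

section \<open>Opposite simplices and parabolic cosets of the longest element\<close>

lemma up_rtrancl_parabolic_longest:
  assumes "up\<^sup>*\<^sup>* u z" "K \<subseteq> S" "\<exists>x\<in>generate W K. u = x \<otimes> longest"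
  shows "\<exists>x\<in>generate W K. z = x \<otimes> longest"
  using assms(1,3)
proof (induction rule: rtranclp_induct)
  case (step y z)
  then obtain x where "x \<in> generate W K" "y = x \<otimes> longest" by blast
  then show ?case
    using step.hyps(2) ascent_parabolic_longest[OF spherical assms(2)] by (auto simp: up_def)
qed simp

text \<open>Chambers A and B of the simplex have \<open>longest\<close> as distance from A to the
  image of B. Replacing A by B inside the residue changes this distance by a left factor from the
  parabolic subgroup.\<close>

lemma opposite_image_displ:
  assumes "simplex_of_type J \<alpha>" "opposite \<alpha> (\<theta> ` \<alpha>)"
  shows "\<exists>C\<in>Ch. \<exists>x\<in>generate W (S - J). displ C = x \<otimes> longest"
    and "\<sigma> ` J = (\<lambda>s. longest \<otimes> s \<otimes> longest) ` J"
proof -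
  obtain J' A B where J': "simplex_of_type J' \<alpha>" "simplex_of_type ((\<lambda>s. longest \<otimes> s \<otimes> longest) ` J') (\<theta> ` \<alpha>)"
    and A: "A \<in> \<alpha>" and B: "B \<in> \<alpha>" and AB: "\<delta> A (\<theta> B) = longest"
    using assms(2) by (auto simp: opposite_def)
  have "J' = J" using simplex_type_unique J' assms by blast
  then show "\<sigma> ` J = (\<lambda>s. longest \<otimes> s \<otimes> longest) ` J"
    using simplex_type_unique[OF simplex_image[OF assms(1)]] J' by simp
  have "A \<in> Ch" "B \<in> Ch" using simplex_subset assms A B by auto
  moreover have "\<delta> B A \<in> generate W (S - J)" using simplex_rebase[OF assms(1) B] A by blast
  ultimately obtain x where "x \<in> generate W (S - J)" "displ B = x \<otimes> longest"
    using dist_coset[of "S - J" B A "\<theta> B"] AB by (auto simp: displ_def)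
  then show "\<exists>C\<in>Ch. \<exists>x\<in>generate W (S - J). displ C = x \<otimes> longest"
    using \<open>B \<in> Ch\<close> by blast
qed

lemma opposite_imageI:
  assumes J: "J \<subseteq> S" "\<sigma> ` J = (\<lambda>s. longest \<otimes> s \<otimes> longest) ` J"
    and C: "C \<in> Ch" "x \<in> generate W (S - J)" "displ C = x \<otimes> longest"
  shows "\<exists>\<beta>. simplex_of_type J \<beta> \<and> opposite \<beta> (\<theta> ` \<beta>)"
proof -
  let ?R = "{B \<in> Ch. \<delta> C B \<in> generate W (S - J)}"
  have R: "simplex_of_type J ?R" using J C by (auto simp: simplex_of_type_def)
  have K: "S - J \<subseteq> S" by blast
  \<comment> \<open>Undo the factor x inside the residue of C: A becomes opposite to the image of
    C.\<close>
  obtain A where A: "A \<in> Ch" "\<delta> C A \<in> generate W (S - J)" "\<delta> A (\<theta> C) = inv x \<otimes> \<delta> C (\<theta> C)"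
    using dist_coset_surj[OF K C(1) _ generate_inv[OF K C(2)], of "\<theta> C"] C by auto
  have "\<delta> A (\<theta> C) = longest"
    using A(3) C(3) generate_carrier[OF K C(2)] longest_props(1)[OF spherical] by (simp add: displ_def)
  moreover have "C \<in> ?R" using C by (auto intro: generate.one)
  ultimately have "\<exists>A\<in>?R. \<exists>B\<in>\<theta> ` ?R. \<delta> A B = longest" using A by blast
  moreover have "simplex_of_type ((\<lambda>s. longest \<otimes> s \<otimes> longest) ` J) (\<theta> ` ?R)"
    using simplex_image[OF R] J by simp
  ultimately show ?thesis using R unfolding opposite_def by blast
qed

theorem capped_displacement: "capped \<theta>"
  unfolding capped_def
proof (intro allI impI, elim conjE exE)
  fix J J' \<alpha> \<alpha>'
  assume \<alpha>: "simplex_of_type J \<alpha>" "opposite \<alpha> (\<theta> ` \<alpha>)"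
    and \<alpha>': "simplex_of_type J' \<alpha>'" "opposite \<alpha>' (\<theta> ` \<alpha>')"
  obtain C where C: "C \<in> Ch" "\<exists>x\<in>generate W (S - J). displ C = x \<otimes> longest"
    using opposite_image_displ \<alpha> by blast
  obtain C' where C': "C' \<in> Ch" "\<exists>x\<in>generate W (S - J'). displ C' = x \<otimes> longest"
    using opposite_image_displ \<alpha>' by blast
  obtain z where z: "normal_form (displ C) z" using normal_form_exists[OF displ_closed[OF C(1)]] by blast
  have z': "normal_form (displ C') z" using normal_form_constant C C' z by blast
  obtain x where x: "x \<in> generate W (S - J)" "z = x \<otimes> longest"
    using up_rtrancl_parabolic_longest[of _ z "S - J"] z C by (auto simp: normal_form_def)
  obtain x' where x': "x' \<in> generate W (S - J')" "z = x' \<otimes> longest"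
    using up_rtrancl_parabolic_longest[of _ z "S - J'"] z' C' by (auto simp: normal_form_def)
  have "x \<in> carrier W" "x' \<in> carrier W"
    using x x' generate_carrier[of "S - J"] generate_carrier[of "S - J'"] by blast+
  then have "x = x'" using x(2) x'(2) longest_props(1)[OF spherical] by simp
  then have "x \<in> generate W ((S - J) \<inter> (S - J'))"
    using parabolic_Int[of "S - J" "S - J'" x] x x' by auto
  moreover have "(S - J) \<inter> (S - J') = S - (J \<union> J')" by blast
  ultimately have xJ: "x \<in> generate W (S - (J \<union> J'))" by simp
  \<comment> \<open>The normal form is itself a displacement, being reached from one by
    \<open>up\<close>.\<close>
  obtain D where D: "D \<in> Ch" "displ D = z"
    using up_rtrancl_displ[of C z] z C by (auto simp: normal_form_def)
  have "J \<union> J' \<subseteq> S" using \<alpha> \<alpha>' by (auto simp: simplex_of_type_def)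
  moreover have "\<sigma> ` (J \<union> J') = (\<lambda>s. longest \<otimes> s \<otimes> longest) ` (J \<union> J')"
    using opposite_image_displ(2)[OF \<alpha>] opposite_image_displ(2)[OF \<alpha>'] by (simp add: image_Un)
  ultimately show "\<exists>\<beta>. simplex_of_type (J \<union> J') \<beta> \<and> opposite \<beta> (\<theta> ` \<beta>)"
    using opposite_imageI D x xJ by blast
qed

end

theorem theorem3p4:
  fixes W :: "('w, 'b) monoid_scheme" and S :: "'w set"
    and Ch :: "'c set" and \<delta> :: "'c \<Rightarrow> 'c \<Rightarrow> 'w" and \<theta> :: "'c \<Rightarrow> 'c"
  assumes "building W S Ch \<delta>"
    and "building.thick W S Ch \<delta>"
    and "coxeter_system.irreducible_type W S"
    and "coxeter_system.spherical_type W"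
    and "building.automorphism W S Ch \<delta> \<theta>"
    and "building.uniclass W S Ch \<delta> \<theta>"
  shows "building.capped W S Ch \<delta> \<theta>"
proof -
  interpret building W S Ch \<delta> by fact
  obtain \<sigma> w where \<sigma>: "companion \<theta> \<sigma>" "graph_automorphism \<sigma>" and w: "w \<in> carrier W" "disp \<theta> \<subseteq> twisted_class \<sigma> w"
    using assms(6) by (auto simp: uniclass_def companion_def)
  \<comment> \<open>The factors \<open>inv v\<close> and \<open>\<sigma> v\<close> have equal
    lengths, so their contributions to the parity cancel.\<close>
  have parity: "even (len (\<delta> C (\<theta> C))) = even (len w)" if "C \<in> Ch" for C
  proof -
    have "\<delta> C (\<theta> C) \<in> twisted_class \<sigma> w" using w that by (auto simp: disp_def)
    then obtain v where v: "v \<in> carrier W" "\<delta> C (\<theta> C) = inv\<^bsub>W\<^esub> v \<otimes>\<^bsub>W\<^esub> w \<otimes>\<^bsub>W\<^esub> \<sigma> v"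
      by (auto simp: twisted_class_def)
    then show ?thesis
      using w even_len_mult[of "inv\<^bsub>W\<^esub> v \<otimes>\<^bsub>W\<^esub> w" "\<sigma> v"] even_len_mult[of "inv\<^bsub>W\<^esub> v" w]
        graph_closed[OF \<sigma>(2)] graph_len[OF \<sigma>(2)] by auto
  qed
  interpret even_displacement W S Ch \<delta> \<theta> \<sigma>
    using assms(2,4,5) \<sigma> parity by unfold_locales (auto simp: automorphism_def)
  show ?thesis by (rule capped_displacement)
qed

end
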